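(* Assume $\bar\rho\in(\rho_*,\rho^* )$, $\bar v\in(0,\epsilon^{-1})$ and $\frac{|\bar v|}{\bar c}>\frac{\sqrt2}{\sqrt{1+\epsilon^2\bar c^2}}$. Then there is a positive constant $z_1$ satisfying $$0<z_1<\bar C_2-\bar C_1^{-1}<\bar C_2<\bar v<\bar C_2+\bar C_1^{-1}$$ such that, for any $(\tau,\eta)\in\Xi_1$, $$\Delta(\tau,\eta)=0\quad\text{if and only if}\quad\tau\in\{0,\pm\mathrm iz_1\eta\}.$$ Moreover, each of these roots is simple in the sense that, if $q\in\{0,-z_1,z_1\}$, then (for $\eta$ with $(\mathrm iq\eta,\eta)\in\Xi_1$) there exist a neighborhood $\mathscr V$ of $(\mathrm iq\eta,\eta)$ in $\Xi_1$ and a $C^\infty$ function $h_q$ defined on $\mathscr V$ such that $$\Delta(\tau,\eta)=(\tau-\mathrm iq\eta)h_q(\tau,\eta),\qquad h_q(\tau,\eta)\ne0\qquad\text{for all }(\tau,\eta)\in\mathscr V.$$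
   Context: Constants. Fix $\epsilon>0$, $0\le\rho_*<\rho^*\le\infty$, $p\in C^\infty((\rho_*,\rho^* ))$ with $0<p'(\rho)<\epsilon^{-2}$. For given $\bar\rho,\bar v$ put $\bar c=\sqrt{p'(\bar\rho)}\in(0,\epsilon^{-1})$, $\bar h=\bar\rho+\epsilon^2p(\bar\rho)$ (implicitly positive), $\bar\Gamma=(1-\epsilon^2\bar v^2)^{-1/2}$, and $$\bar C_1=\frac{1-\epsilon^4\bar c^2\bar v^2}{(1-\epsilon^2\bar v^2)\bar c},\qquad\bar C_2=\frac{(1-\epsilon^2\bar c^2)\bar v}{1-\epsilon^4\bar c^2\bar v^2}.$$ Frequencies: $\Xi_1=\{(\tau,\eta)\in\mathbb{C}\times\mathbb{R}:|\tau|^2+\eta^2=1,\ \mathrm{Re}\,\tau\ge0\}$. Put $$\mu_\pm=\frac{\bar\Gamma(\tau\pm\mathrm i\bar v\eta)}{\bar c}-m_\pm,\qquad m_\pm=\frac{\bar c\bar\Gamma(\mathrm i\eta\pm\epsilon^2\bar v\tau)^2}{2(\tau\pm\mathrm i\bar v\eta)}.$$ For $(\tau,\eta)\in\Xi_1$ with $\mathrm{Re}\,\tau>0$, let $\omega_\pm$ be the unique root with negative real part of $$\omega_\pm^2=\mu_\pm^2-m_\pm^2=\frac{\bar\Gamma^2}{\bar c^2}(\tau\pm\mathrm i\eta\bar v)^2-\bar\Gamma^2(\mathrm i\eta\pm\epsilon^2\bar v\tau)^2,$$ extended continuously to $\mathrm{Re}\,\tau=0$. The vectors $$E_+=\big((\tau+\mathrm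 i\bar v\eta)m_+,(\tau+\mathrm i\bar v\eta)(\mu_+-\omega_+),0,0\big)^{\mathsf T},\quad E_-=\big(0,0,(\tau-\mathrm i\bar v\eta)(\mu_--\omega_-),(\tau-\mathrm i\bar v\eta)m_-\big)^{\mathsf T}$$ are likewise extended continuously to all of $\Xi_1$. On $\Xi_1$ let $$\beta(\tau,\eta)=\begin{pmatrix}1&1&-1&-1\\ \frac{\tau-\mathrm i\bar v\eta}{\bar\Gamma\bar c\bar h}&\frac{-\tau+\mathrm i\bar v\eta}{\bar\Gamma\bar c\bar h}&\frac{-\tau-\mathrm i\bar v\eta}{\bar\Gamma\bar c\bar h}&\frac{\tau+\mathrm i\bar v\eta}{\bar\Gamma\bar c\bar h}\end{pmatrix}.$$ The Lopatinskii determinant is $\Delta(\tau,\eta)=\det\big[\beta(\tau,\eta)\,(E_+(\tau,\eta)\ \ E_-(\tau,\eta))\big]$. *)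

theory Defs
  imports "HOL-Analysis.Analysis"
begin

text \<open>Real \<open>C\<^sup>k\<close> and \<open>C\<^sup>\<infinity>\<close> regularity.  In finite dimension, iterating directional
  derivatives of differentiable functions gives the usual notion of \<open>C\<^sup>k\<close> on open sets; it is only
  used with open \<open>S\<close>.\<close>

fun Ck_on :: "nat \<Rightarrow> ('a::real_normed_vector \<Rightarrow> 'b::real_normed_vector) \<Rightarrow> 'a set \<Rightarrow> bool" where
  "Ck_on 0 f S \<longleftrightarrow> continuous_on S f"
| "Ck_on (Suc k) f S \<longleftrightarrow> (\<forall>x\<in>S. f differentiable (at x)) \<and>
     (\<forall>w. Ck_on k (\<lambda>x. frechet_derivative f (at x) w) S)"

definition smooth_on_open :: "('a::real_normed_vector \<Rightarrow> 'b::real_normed_vector) \<Rightarrow> 'a set \<Rightarrow> bool" where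
  "smooth_on_open f S \<longleftrightarrow> open S \<and> (\<forall>k. Ck_on k f S)"

text \<open>\<open>C\<^sup>\<infinity>\<close> on an arbitrary subset of the ambient space, as usual for embedded manifolds with
  boundary: locally the restriction of a \<open>C\<^sup>\<infinity>\<close> function of the ambient space.\<close>

definition smooth_on_subset :: "('a::real_normed_vector \<Rightarrow> 'b::real_normed_vector) \<Rightarrow> 'a set \<Rightarrow> bool" where
  "smooth_on_subset f V \<longleftrightarrow>
     (\<forall>x\<in>V. \<exists>U F. x \<in> U \<and> smooth_on_open F U \<and> (\<forall>y\<in>U \<inter> V. F y = f y))"

text \<open>Continuous extension from \<open>D\<close> to points of its closure (arbitrary where no limit exists).\<close>

definition cont_ext :: "('a::t2_space \<Rightarrow> 'b::t2_space) \<Rightarrow> 'a set \<Rightarrow> 'a \<Rightarrow> 'b" where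
  "cont_ext f D x = (if x \<in> D then f x else Lim (at x within D) f)"

definition Xi1 :: "(complex \<times> real) set" where
  "Xi1 = {(\<tau>, \<eta>). (norm \<tau>)\<^sup>2 + \<eta>\<^sup>2 = 1 \<and> Re \<tau> \<ge> 0}"

definition Gam :: "real \<Rightarrow> real \<Rightarrow> real" where
  "Gam \<epsilon> v = 1 / sqrt (1 - \<epsilon>\<^sup>2 * v\<^sup>2)"

definition C1 :: "real \<Rightarrow> real \<Rightarrow> real \<Rightarrow> real" where
  "C1 \<epsilon> c v = (1 - \<epsilon>^4 * c\<^sup>2 * v\<^sup>2) / ((1 - \<epsilon>\<^sup>2 * v\<^sup>2) * c)"

definition C2 :: "real \<Rightarrow> real \<Rightarrow> real \<Rightarrow> real" where
  "C2 \<epsilon> c v = (1 - \<epsilon>\<^sup>2 * c\<^sup>2) * v / (1 - \<epsilon>^4 * c\<^sup>2 * v\<^sup>2)"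

text \<open>Below, the argument \<open>s\<close> is the sign \<open>1\<close> or \<open>-1\<close>, standing for the subscript plus or minus.\<close>

definition transp :: "real \<Rightarrow> real \<Rightarrow> complex \<times> real \<Rightarrow> complex" where
  "transp v s = (\<lambda>(\<tau>, \<eta>). \<tau> + of_real s * \<i> * of_real v * of_real \<eta>)"

definition m_fn :: "real \<Rightarrow> real \<Rightarrow> real \<Rightarrow> real \<Rightarrow> complex \<times> real \<Rightarrow> complex" where
  "m_fn \<epsilon> c v s = (\<lambda>(\<tau>, \<eta>).
     of_real c * of_real (Gam \<epsilon> v) * (\<i> * of_real \<eta> + of_real s * of_real (\<epsilon>\<^sup>2) * of_real v * \<tau>)\<^sup>2
       / (2 * transp v s (\<tau>, \<eta>)))"

definition mu_fn :: "real \<Rightarrow> real \<Rightarrow> real \<Rightarrow> real \<Rightarrow> complex \<times> real \<Rightarrow> complex" where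
  "mu_fn \<epsilon> c v s x = of_real (Gam \<epsilon> v) * transp v s x / of_real c - m_fn \<epsilon> c v s x"

text \<open>The explicit form of \<open>\<mu>\<^sup>2 - m\<^sup>2\<close>, which is defined for all frequencies.\<close>

definition omega_sq :: "real \<Rightarrow> real \<Rightarrow> real \<Rightarrow> real \<Rightarrow> complex \<times> real \<Rightarrow> complex" where
  "omega_sq \<epsilon> c v s = (\<lambda>(\<tau>, \<eta>).
     (of_real (Gam \<epsilon> v))\<^sup>2 / (of_real c)\<^sup>2 * (\<tau> + of_real s * \<i> * of_real \<eta> * of_real v)\<^sup>2
       - (of_real (Gam \<epsilon> v))\<^sup>2 * (\<i> * of_real \<eta> + of_real s * of_real (\<epsilon>\<^sup>2) * of_real v * \<tau>)\<^sup>2)"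

definition omega_interior :: "real \<Rightarrow> real \<Rightarrow> real \<Rightarrow> real \<Rightarrow> complex \<times> real \<Rightarrow> complex" where
  "omega_interior \<epsilon> c v s x = (THE w. w\<^sup>2 = omega_sq \<epsilon> c v s x \<and> Re w < 0)"

definition omega :: "real \<Rightarrow> real \<Rightarrow> real \<Rightarrow> real \<Rightarrow> complex \<times> real \<Rightarrow> complex" where
  "omega \<epsilon> c v s = cont_ext (omega_interior \<epsilon> c v s) {x \<in> Xi1. Re (fst x) > 0}"

text \<open>\<open>E\<^sub>\<plusminus>\<close> are given by their formulas off the pole of \<open>m\<^sub>\<plusminus>\<close> and by continuous extension there.\<close>

definition E_plus :: "real \<Rightarrow> real \<Rightarrow> real \<Rightarrow> complex \<times> real \<Rightarrow> complex ^ 4" where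
  "E_plus \<epsilon> c v = cont_ext
     (\<lambda>x. vector [transp v 1 x * m_fn \<epsilon> c v 1 x,
                  transp v 1 x * (mu_fn \<epsilon> c v 1 x - omega \<epsilon> c v 1 x), 0, 0])
     {x \<in> Xi1. transp v 1 x \<noteq> 0}"

definition E_minus :: "real \<Rightarrow> real \<Rightarrow> real \<Rightarrow> complex \<times> real \<Rightarrow> complex ^ 4" where
  "E_minus \<epsilon> c v = cont_ext
     (\<lambda>x. vector [0, 0, transp v (-1) x * (mu_fn \<epsilon> c v (-1) x - omega \<epsilon> c v (-1) x),
                  transp v (-1) x * m_fn \<epsilon> c v (-1) x])
     {x \<in> Xi1. transp v (-1) x \<noteq> 0}"

definition \<beta> :: "real \<Rightarrow> real \<Rightarrow> real \<Rightarrow> real \<Rightarrow> complex \<times> real \<Rightarrow> complex ^ 4 ^ 2" where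
  "\<beta> \<epsilon> c v h = (\<lambda>(\<tau>, \<eta>).
     let a = \<i> * of_real v * of_real \<eta>; k = of_real (Gam \<epsilon> v * c * h) in
     vector [vector [1, 1, -1, -1],
             vector [(\<tau> - a) / k, (- \<tau> + a) / k, (- \<tau> - a) / k, (\<tau> + a) / k]])"

definition Lopatinskii :: "real \<Rightarrow> real \<Rightarrow> real \<Rightarrow> real \<Rightarrow> complex \<times> real \<Rightarrow> complex" where
  "Lopatinskii \<epsilon> c v h x =
     det (\<beta> \<epsilon> c v h x ** transpose (vector [E_plus \<epsilon> c v x, E_minus \<epsilon> c v x] :: complex ^ 4 ^ 2))"

end

theory Submission
  imports Defs
begin

text \<open>With \<open>a\<^sub>\<plusminus> = \<tau> \<plusminus> \<i> v \<eta>\<close> one has \<open>\<omega>\<^sub>\<plusminus> = - (\<Gamma> \<surd>Q / c) W\<^sub>\<plusminus>\<close> up to the boundary, where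
  \<open>Q = 1 - \<epsilon>\<^sup>4 c\<^sup>2 v\<^sup>2\<close> and \<open>W\<^sub>\<plusminus>\<close> is the product of the principal square roots of
  \<open>\<tau> \<plusminus> \<i> \<eta> C\<^sub>2 + \<i> \<eta> / C\<^sub>1\<close> and \<open>\<tau> \<plusminus> \<i> \<eta> C\<^sub>2 - \<i> \<eta> / C\<^sub>1\<close>; this product has positive real part in
  the interior and is continuous on the closed half plane.  The determinant is a nonzero constant times
  \<open>(a\<^sub>+ + \<surd>Q W\<^sub>+) (a\<^sub>- + \<surd>Q W\<^sub>-) (a\<^sub>+\<^sup>2 W\<^sub>- + a\<^sub>-\<^sup>2 W\<^sub>+)\<close>, whose first two factors never vanish.
  Multiplying the third one by its conjugate \<open>a\<^sub>+\<^sup>2 W\<^sub>- - a\<^sub>-\<^sup>2 W\<^sub>+\<close> gives a polynomial, a multiple of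
  \<open>\<eta> \<tau> (\<tau>\<^sup>2 + z\<^sub>1\<^sup>2 \<eta>\<^sup>2) (\<tau>\<^sup>2 + z\<^sub>2\<^sup>2 \<eta>\<^sup>2)\<close> with \<open>z\<^sub>1 < C\<^sub>2 - 1 / C\<^sub>1\<close> and \<open>C\<^sub>2 + 1 / C\<^sub>1 < z\<^sub>2\<close>.  For \<open>\<eta> \<noteq> 0\<close>
  all its roots lie on the imaginary axis, where the signs of \<open>W\<^sub>\<plusminus> / (\<i> \<eta>)\<close> decide which factor vanishes: they are
  opposite at \<open>0\<close> and \<open>\<plusminus>\<i> z\<^sub>1 \<eta>\<close>, which are therefore roots of the third factor and not of its conjugate,
  and equal at \<open>\<plusminus>\<i> z\<^sub>2 \<eta>\<close>, which are spurious.\<close>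

section \<open>Smoothness of elementary functions\<close>

text \<open>Derivatives are local on an open set, so agreement of functions passes to their
  directional derivatives. This lets an explicit derivative stand in for
  \<open>frechet_derivative\<close>.\<close>

lemma Ck_on_cong:
  assumes "open S" "\<And>x. x \<in> S \<Longrightarrow> f x = g x" "Ck_on k f S"
  shows "Ck_on k g S"
  using assms(2,3)
proof (induction k arbitrary: f g)
  case 0
  then show ?case by (simp cong: continuous_on_cong)
next
  case (Suc k)
  have diff: "f differentiable (at x)" if "x \<in> S" for x
    using Suc.prems(2) that by simp
  have "g differentiable (at x)" if "x \<in> S" for x
    using diff[OF that] Suc.prems(1)
    by (metis assms(1) differentiable_def has_derivative_transform_within_open that)
  moreover have "frechet_derivative f (at x) = frechet_derivative g (at x)" if "x \<in> S" for x
    using frechet_derivative_transform_within_open[OF diff[OF that] \<open>open S\<close> that Suc.prems(1)]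
    by blast
  then have "Ck_on k (\<lambda>x. frechet_derivative g (at x) w) S" for w
    using Suc.prems(2) by - (rule Suc.IH[of "\<lambda>x. frechet_derivative f (at x) w" "\<lambda>x. frechet_derivative g (at x) w"]; simp)
  ultimately show ?case by simp
qed

text \<open>This class of functions is closed under directional derivatives, so its members are \<open>C\<^sup>\<infinity>\<close>.\<close>

inductive elementary_on :: "'a::real_normed_vector set \<Rightarrow> ('a \<Rightarrow> complex) \<Rightarrow> bool"
  for S :: "'a set" where
  const: "elementary_on S (\<lambda>x. a)"
| linear: "bounded_linear f \<Longrightarrow> elementary_on S f"
| add: "elementary_on S f \<Longrightarrow> elementary_on S g \<Longrightarrow> elementary_on S (\<lambda>x. f x + g x)"
| mult: "elementary_on S f \<Longrightarrow> elementary_on S g \<Longrightarrow> elementary_on S (\<lambda>x. f x * g x)"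
| inverse: "elementary_on S f \<Longrightarrow> (\<And>x. x \<in> S \<Longrightarrow> f x \<noteq> 0) \<Longrightarrow> elementary_on S (\<lambda>x. inverse (f x))"
| csqrt: "elementary_on S f \<Longrightarrow> (\<And>x. x \<in> S \<Longrightarrow> f x \<notin> \<real>\<^sub>\<le>\<^sub>0) \<Longrightarrow> elementary_on S (\<lambda>x. csqrt (f x))"

lemma elementary_on_diff:
  assumes "elementary_on S f" "elementary_on S g"
  shows "elementary_on S (\<lambda>x. f x - g x)"
  using elementary_on.add[OF assms(1) elementary_on.mult[OF elementary_on.const[of S "-1"] assms(2)]]
  by simp

lemma elementary_on_divide:
  assumes "elementary_on S f" "elementary_on S g" "\<And>x. x \<in> S \<Longrightarrow> g x \<noteq> 0"
  shows "elementary_on S (\<lambda>x. f x / g x)"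
  using elementary_on.mult[OF assms(1) elementary_on.inverse[OF assms(2,3)]]
  by (simp add: divide_inverse)

lemma elementary_on_power:
  assumes "elementary_on S f"
  shows "elementary_on S (\<lambda>x. f x ^ n)"
  by (induction n) (auto intro: elementary_on.const elementary_on.mult[OF assms])

lemmas elementary_on_intros =
  elementary_on.const elementary_on.add elementary_on.mult elementary_on_diff elementary_on_power

text \<open>Rule induction with the usual differentiation rules. The side conditions of
  \<open>inverse\<close> and \<open>csqrt\<close> keep denominators nonzero and arguments off the
  cut, so each derivative formula stays in the class.\<close>

lemma elementary_on_has_derivative:
  assumes "elementary_on S f"
  shows "\<exists>f'. (\<forall>x\<in>S. (f has_derivative f' x) (at x)) \<and> (\<forall>w. elementary_on S (\<lambda>x. f' x w))"
  using assms
proof induction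
  case (const a)
  show ?case
    by (rule exI[of _ "\<lambda>x w. 0"]) (auto intro: elementary_on.const)
next
  case (linear f)
  then show ?case
    by (intro exI[of _ "\<lambda>x. f"]) (auto intro: elementary_on.const bounded_linear_imp_has_derivative)
next
  case (add f g)
  then obtain f' g' where
    "\<forall>x\<in>S. (f has_derivative f' x) (at x)" "\<forall>w. elementary_on S (\<lambda>x. f' x w)"
    "\<forall>x\<in>S. (g has_derivative g' x) (at x)" "\<forall>w. elementary_on S (\<lambda>x. g' x w)" by blast
  then show ?case
    by (intro exI[of _ "\<lambda>x w. f' x w + g' x w"])
      (auto intro: elementary_on.add has_derivative_add)
next
  case (mult f g)
  then obtain f' g' where
    "\<forall>x\<in>S. (f has_derivative f' x) (at x)" "\<forall>w. elementary_on S (\<lambda>x. f' x w)"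
    "\<forall>x\<in>S. (g has_derivative g' x) (at x)" "\<forall>w. elementary_on S (\<lambda>x. g' x w)" by blast
  then show ?case
    by (intro exI[of _ "\<lambda>x w. f x * g' x w + f' x w * g x"])
      (auto intro!: elementary_on.add elementary_on.mult mult.hyps has_derivative_mult)
next
  case (inverse f)
  then obtain f' where f':
    "\<forall>x\<in>S. (f has_derivative f' x) (at x)" "\<forall>w. elementary_on S (\<lambda>x. f' x w)" by blast
  have "((\<lambda>x. inverse (f x)) has_derivative (\<lambda>w. - (inverse (f x) * f' x w * inverse (f x)))) (at x)"
    if "x \<in> S" for x
    using inverse.hyps(2)[OF that] f'(1) that by (intro Deriv.has_derivative_inverse) auto
  moreover have "elementary_on S (\<lambda>x. - (inverse (f x) * f' x w * inverse (f x)))" for w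
    using elementary_on.mult[OF elementary_on.const[of S "-1"]
        elementary_on.mult[OF elementary_on.mult[OF _ f'(2)[rule_format, of w]]]]
      elementary_on.inverse[OF inverse.hyps(1,2)] by simp
  ultimately show ?case
    by (intro exI[of _ "\<lambda>x w. - (inverse (f x) * f' x w * inverse (f x))"]) auto
next
  case (csqrt f)
  then obtain f' where f':
    "\<forall>x\<in>S. (f has_derivative f' x) (at x)" "\<forall>w. elementary_on S (\<lambda>x. f' x w)" by blast
  have "((\<lambda>x. csqrt (f x)) has_derivative (\<lambda>w. inverse (2 * csqrt (f x)) * f' x w)) (at x)"
    if "x \<in> S" for x
  proof -
    have "(csqrt has_derivative (*) (inverse (2 * csqrt (f x)))) (at (f x))"
      using has_field_derivative_csqrt[OF csqrt.hyps(2)[OF that]] by (simp add: has_field_derivative_def)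
    from has_derivative_compose[OF f'(1)[rule_format, OF that] this] show ?thesis
      by (simp add: o_def)
  qed
  moreover have "elementary_on S (\<lambda>x. inverse (2 * csqrt (f x)) * f' x w)" for w
  proof (intro elementary_on.mult elementary_on.inverse elementary_on.csqrt elementary_on.const)
    show "2 * csqrt (f x) \<noteq> 0" if "x \<in> S" for x
      using csqrt.hyps(2)[OF that] by auto
  qed (use csqrt.hyps f' in auto)
  ultimately show ?case
    by (intro exI[of _ "\<lambda>x w. inverse (2 * csqrt (f x)) * f' x w"]) auto
qed

lemma elementary_on_continuous:
  assumes "elementary_on S f"
  shows "continuous_on S f"
  using elementary_on_has_derivative[OF assms]
  by (metis has_derivative_continuous continuous_at_imp_continuous_on)

text \<open>Induction on \<open>k\<close> for all \<open>f\<close> at once: each directional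
  derivative is again elementary, so the induction hypothesis applies to it.\<close>

lemma elementary_on_smooth:
  assumes "open S" "elementary_on S f"
  shows "smooth_on_open f S"
proof -
  have "Ck_on k f S" for k
    using assms(2)
  proof (induction k arbitrary: f)
    case 0
    then show ?case by (simp add: elementary_on_continuous)
  next
    case (Suc k)
    from elementary_on_has_derivative[OF Suc.prems] obtain f' where
      "\<forall>x\<in>S. (f has_derivative f' x) (at x)" "\<forall>w. elementary_on S (\<lambda>x. f' x w)"
      by blast
    then have f': "\<And>x. x \<in> S \<Longrightarrow> (f has_derivative f' x) (at x)" "\<And>w. elementary_on S (\<lambda>x. f' x w)"
      by simp_all
    have "Ck_on k (\<lambda>x. frechet_derivative f (at x) w) S" for w
    proof (rule Ck_on_cong[OF assms(1) _ Suc.IH[OF f'(2)]])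
      show "f' x w = frechet_derivative f (at x) w" if "x \<in> S" for x
        by (simp only: frechet_derivative_at[OF f'(1)[OF that], symmetric])
    qed
    then show ?case using f'(1) by (auto simp: differentiable_def)
  qed
  then show ?thesis using assms(1) by (simp add: smooth_on_open_def)
qed

section \<open>The square root of \<open>s\<^sup>2 + d\<^sup>2\<close> with positive real part\<close>

text \<open>A single \<open>csqrt (s\<^sup>2 + d\<^sup>2)\<close> would jump on the boundary, at
  \<open>s = \<i> y\<close> with \<open>y < - \<bar>d\<bar>\<close>. Both factors here have
  arguments in the closed right half plane whenever \<open>s\<close> lies in it.\<close>

definition branch :: "real \<Rightarrow> complex \<Rightarrow> complex" where
  "branch d s = csqrt (s + \<i> * of_real d) * csqrt (s - \<i> * of_real d)"

lemma branch_power2: "(branch d s)\<^sup>2 = s\<^sup>2 + (of_real d)\<^sup>2"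
  by (simp add: branch_def power_mult_distrib) (simp add: algebra_simps power2_eq_square)

lemma branch_0 [simp]: "branch 0 s = s"
  using power2_csqrt[of s] by (simp add: branch_def power2_eq_square del: csqrt.simps power2_csqrt)

text \<open>The real part of a square is the difference of the squared parts; geometrically, the
  root has argument strictly between -pi/4 and pi/4.\<close>

lemma Im_csqrt_less_Re:
  assumes "0 < Re z"
  shows "\<bar>Im (csqrt z)\<bar> < Re (csqrt z)"
proof -
  have "Re z = (Re (csqrt z))\<^sup>2 - (Im (csqrt z))\<^sup>2"
    using Re_power2[of "csqrt z"] by (simp only: power2_csqrt)
  then have "\<not> \<bar>Re (csqrt z)\<bar> \<le> \<bar>Im (csqrt z)\<bar>"
    using assms by (simp add: abs_le_square_iff del: csqrt.simps)
  moreover have "0 \<le> Re (csqrt z)"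
    using csqrt_principal[of z] by linarith
  ultimately show ?thesis by simp
qed

text \<open>Both factors have argument strictly between -pi/4 and pi/4, so the argument of the
  product stays strictly between -pi/2 and pi/2.\<close>

lemma Re_branch_pos:
  assumes "0 < Re s"
  shows "0 < Re (branch d s)"
proof -
  define p q where "p = csqrt (s + \<i> * of_real d)" and "q = csqrt (s - \<i> * of_real d)"
  have "\<bar>Im p\<bar> < Re p" "\<bar>Im q\<bar> < Re q"
    unfolding p_def q_def using assms by (auto intro!: Im_csqrt_less_Re simp del: csqrt.simps)
  then have "\<bar>Im p\<bar> * \<bar>Im q\<bar> < Re p * Re q"
    by (intro mult_strict_mono) auto
  moreover have "Im p * Im q \<le> \<bar>Im p\<bar> * \<bar>Im q\<bar>"
    by (metis abs_ge_self abs_mult)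
  ultimately show ?thesis
    by (simp add: branch_def flip: p_def q_def del: csqrt.simps)
qed

text \<open>The closed right half plane meets the cut only at 0, where continuity follows from
  \<open>norm (csqrt w) = sqrt (norm w)\<close>.\<close>

lemma continuous_on_csqrt_halfplane: "continuous_on {z. 0 \<le> Re z} csqrt"
proof (intro continuous_at_imp_continuous_on ballI)
  fix z :: complex assume "z \<in> {z. 0 \<le> Re z}"
  show "isCont csqrt z"
  proof (cases "z = 0")
    case True
    have "((\<lambda>w. sqrt (norm w)) \<longlongrightarrow> 0) (at (0::complex))"
      by (auto intro!: tendsto_eq_intros)
    moreover have "norm (csqrt w) = sqrt (norm w)" for w
      using norm_power[of "csqrt w" 2]
      by (intro real_sqrt_unique[symmetric]) (simp_all del: csqrt.simps)
    ultimately have "(csqrt \<longlongrightarrow> 0) (at 0)"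
      by (intro tendsto_norm_zero_cancel[of csqrt]) (simp del: csqrt.simps)
    then show ?thesis using True by (simp add: isCont_def)
  next
    case False
    then show ?thesis
      using \<open>z \<in> {z. 0 \<le> Re z}\<close>
      by (intro continuous_at_csqrt) (auto simp: complex_nonpos_Reals_iff complex_eq_iff)
  qed
qed

lemma continuous_on_branch:
  fixes f :: "'a::topological_space \<Rightarrow> complex"
  assumes "continuous_on S d" "continuous_on S f" "\<And>x. x \<in> S \<Longrightarrow> 0 \<le> Re (f x)"
  shows "continuous_on S (\<lambda>x. branch (d x) (f x))"
  unfolding branch_def
proof (intro continuous_on_mult)
  show "continuous_on S (\<lambda>x. csqrt (f x + \<i> * of_real (d x)))"
    by (rule continuous_on_compose2[OF continuous_on_csqrt_halfplane])
      (intro continuous_intros assms, use assms(3) in auto)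
  show "continuous_on S (\<lambda>x. csqrt (f x - \<i> * of_real (d x)))"
    by (rule continuous_on_compose2[OF continuous_on_csqrt_halfplane])
      (intro continuous_intros assms, use assms(3) in auto)
qed

text \<open>Both radicands are imaginary and on the same side as \<open>y\<close>. Their roots are
  positive multiples of \<open>1 + \<i>\<close> or of \<open>1 - \<i>\<close>, with product a
  multiple of \<open>2 * \<i>\<close> or \<open>- 2 * \<i>\<close>; this produces
  \<open>sgn y\<close>.\<close>

lemma branch_imaginary:
  assumes "\<bar>d\<bar> < \<bar>y\<bar>"
  shows "branch d (\<i> * of_real y) = \<i> * of_real (sgn y * sqrt (y\<^sup>2 - d\<^sup>2))"
proof -
  have up: "csqrt (\<i> * of_real t) = of_real (sqrt (t / 2)) * (1 + \<i>)" if "0 < t" for t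
    using that by (intro csqrt_unique)
      (auto simp: complex_eq_iff Re_power2 Im_power2 mult.assoc)
  have down: "csqrt (- (\<i> * of_real t)) = of_real (sqrt (t / 2)) * (1 - \<i>)" if "0 < t" for t
    using that by (intro csqrt_unique)
      (auto simp: complex_eq_iff Re_power2 Im_power2 mult.assoc)
  have i2: "(1 + \<i>) * (1 + \<i>) = 2 * \<i>" "(1 - \<i>) * (1 - \<i>) = - 2 * \<i>"
    by (auto simp: algebra_simps)
  have half: "sqrt (a / 2) * sqrt (b / 2) = sqrt (a * b) / 2" for a b :: real
    by (simp add: real_sqrt_divide real_sqrt_mult)
  show ?thesis
  proof (cases "0 < y")
    case True
    then have pos: "0 < y + d" "0 < y - d" using assms by auto
    have "branch d (\<i> * of_real y) = csqrt (\<i> * of_real (y + d)) * csqrt (\<i> * of_real (y - d))"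
      by (simp add: branch_def algebra_simps del: csqrt.simps)
    also have "\<dots> = of_real (sqrt ((y + d) / 2) * sqrt ((y - d) / 2)) * ((1 + \<i>) * (1 + \<i>))"
      unfolding up[OF pos(1)] up[OF pos(2)] by (simp only: of_real_mult mult_ac)
    also have "sqrt ((y + d) / 2) * sqrt ((y - d) / 2) = sqrt (y\<^sup>2 - d\<^sup>2) / 2"
      unfolding half by (simp add: power2_eq_square algebra_simps)
    finally show ?thesis using True by (simp add: i2)
  next
    case False
    then have pos: "0 < - y - d" "0 < - y + d" using assms by auto
    have "branch d (\<i> * of_real y) = csqrt (- (\<i> * of_real (- y - d))) * csqrt (- (\<i> * of_real (- y + d)))"
      by (simp add: branch_def algebra_simps del: csqrt.simps)
    also have "\<dots> = of_real (sqrt ((- y - d) / 2) * sqrt ((- y + d) / 2)) * ((1 - \<i>) * (1 - \<i>))"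
      unfolding down[OF pos(1)] down[OF pos(2)] by (simp only: of_real_mult mult_ac)
    also have "sqrt ((- y - d) / 2) * sqrt ((- y + d) / 2) = sqrt (y\<^sup>2 - d\<^sup>2) / 2"
      unfolding half by (simp add: power2_eq_square algebra_simps)
    finally show ?thesis using False assms by (simp add: i2)
  qed
qed

section \<open>Continuous extensions to the boundary of the frequency space\<close>

text \<open>A function continuous on a set containing \<open>D\<close> and \<open>x\<close> supplies
  the limit; the limit point condition makes that limit unique.\<close>

lemma cont_ext_eq:
  assumes "continuous_on T g" "D \<subseteq> T" "x \<in> T" "\<And>y. y \<in> D \<Longrightarrow> f y = g y" "x \<notin> D \<Longrightarrow> x islimpt D"
  shows "cont_ext f D x = g x"
proof (cases "x \<in> D")
  case True
  then show ?thesis by (simp add: cont_ext_def assms(4))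
next
  case False
  have "(g \<longlongrightarrow> g x) (at x within T)"
    using assms(1,3) by (simp add: continuous_on_def)
  then have "(g \<longlongrightarrow> g x) (at x within D)"
    using assms(2) tendsto_within_subset by blast
  then have "(f \<longlongrightarrow> g x) (at x within D)"
    by (rule Lim_transform_eventually) (simp add: eventually_at_filter assms(4))
  moreover have "\<not> trivial_limit (at x within D)"
    using assms(5)[OF False] by (simp add: trivial_limit_within)
  ultimately show ?thesis
    using False by (simp add: cont_ext_def tendsto_Lim)
qed

text \<open>Push the point inward by adding \<open>t > 0\<close> to \<open>\<tau>\<close>, then
  rescale it back to the unit sphere.\<close>

lemma Xi1_boundary_islimpt:
  assumes "x \<in> Xi1" "Re (fst x) = 0"
  shows "x islimpt {y \<in> Xi1. 0 < Re (fst y)}"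
proof -
  obtain \<tau> \<eta> where x: "x = (\<tau>, \<eta>)" by (cases x)
  have \<tau>: "Re \<tau> = 0" and norm: "(norm \<tau>)\<^sup>2 + \<eta>\<^sup>2 = 1"
    using assms by (auto simp: x Xi1_def)
  \<comment> \<open>Since \<open>Re \<tau> = 0\<close>, this is the norm of the shifted point
    \<open>(\<tau> + t, \<eta>)\<close>.\<close>
  define n where "n t = sqrt (1 + t\<^sup>2)" for t :: real
  have n: "0 < n t" "(n t)\<^sup>2 = 1 + t\<^sup>2" for t
    by (simp_all add: n_def add_pos_nonneg)
  define y where "y t = ((\<tau> + of_real t) / of_real (n t), \<eta> / n t)" for t
  have "y t \<in> Xi1" if "0 < t" for t
  proof -
    have "(norm (\<tau> + of_real t))\<^sup>2 = (norm \<tau>)\<^sup>2 + t\<^sup>2"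
      by (simp add: cmod_power2 \<tau>)
    then have "(norm (\<tau> + of_real t))\<^sup>2 + \<eta>\<^sup>2 = (n t)\<^sup>2"
      using norm n(2)[of t] by simp
    then have "((norm (\<tau> + of_real t))\<^sup>2 + \<eta>\<^sup>2) / (n t)\<^sup>2 = 1"
      using n(1)[of t] by simp
    moreover have "0 \<le> Re ((\<tau> + of_real t) / of_real (n t))"
      using that n(1)[of t] \<tau> by simp
    moreover have "norm (complex_of_real (n t)) = n t"
      using n(1)[of t] by simp
    ultimately show ?thesis
      unfolding y_def Xi1_def mem_Collect_eq prod.case norm_divide power_divide
      by (simp only: add_divide_distrib simp_thms)
  qed
  moreover have "0 < Re (fst (y t))" if "0 < t" for t
    using that n(1)[of t] \<tau> by (simp add: y_def)
  ultimately have y_mem: "y (inverse (real (Suc k))) \<in> {y \<in> Xi1. 0 < Re (fst y)}" for k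
    by simp
  have "isCont y 0"
    unfolding y_def n_def by (intro continuous_intros) (auto simp: add_nonneg_eq_0_iff)
  then have "(\<lambda>k. y (inverse (real (Suc k)))) \<longlonglongrightarrow> y 0"
    using LIMSEQ_inverse_real_of_nat isCont_tendsto_compose by blast
  moreover have "y 0 = x" by (simp add: y_def n_def x)
  ultimately have "x \<in> closure {y \<in> Xi1. 0 < Re (fst y)}"
    unfolding closure_sequential using y_mem by (intro exI[of _ "\<lambda>k. y (inverse (real (Suc k)))"]) auto
  then show ?thesis
    using assms(2) by (simp add: closure_def)
qed

lemma vector_4 [simp]:
  "(vector [x, y, z, w] :: 'a::zero^4) $ 1 = x"
  "(vector [x, y, z, w] :: 'a::zero^4) $ 2 = y"
  "(vector [x, y, z, w] :: 'a::zero^4) $ 3 = z"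
  "(vector [x, y, z, w] :: 'a::zero^4) $ 4 = w"
  unfolding vector_def by simp_all

lemma continuous_on_vector_4:
  fixes f g h k :: "'a::topological_space \<Rightarrow> 'b::{zero,topological_space}"
  assumes "continuous_on S f" "continuous_on S g" "continuous_on S h" "continuous_on S k"
  shows "continuous_on S (\<lambda>x. vector [f x, g x, h x, k x] :: 'b^4)"
  unfolding continuous_on_def
proof (intro ballI vec_tendstoI)
  fix x i assume "x \<in> S"
  then have "\<forall>i. ((\<lambda>x. (vector [f x, g x, h x, k x] :: 'b^4) $ i) \<longlongrightarrow>
      (vector [f x, g x, h x, k x] :: 'b^4) $ i) (at x within S)"
    using assms by (simp add: forall_4 continuous_on_def)
  then show "((\<lambda>x. (vector [f x, g x, h x, k x] :: 'b^4) $ i) \<longlongrightarrow>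
      (vector [f x, g x, h x, k x] :: 'b^4) $ i) (at x within S)" ..
qed

section \<open>An explicit formula for the Lopatinskii determinant\<close>

locale vortex_sheet =
  fixes \<epsilon> c v :: real
  assumes \<epsilon>_pos: "0 < \<epsilon>" and c_pos: "0 < c" and v_pos: "0 < v"
    and c_less: "\<epsilon> * c < 1" and v_less: "\<epsilon> * v < 1"
begin

abbreviation G where "G \<equiv> Gam \<epsilon> v"
abbreviation K where "K \<equiv> C2 \<epsilon> c v"

text \<open>\<open>Q\<close> clears the denominators of \<open>K\<close> and of \<open>r\<close>. At
  \<open>\<tau> = \<i> \<eta> z\<close>, the radicands in \<open>W s\<close> vanish at
  \<open>z = - s K - r\<close> and \<open>z = - s K + r\<close>.\<close>

definition r where "r = 1 / C1 \<epsilon> c v"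
definition Q where "Q = 1 - \<epsilon>^4 * c\<^sup>2 * v\<^sup>2"
definition W :: "real \<Rightarrow> complex \<times> real \<Rightarrow> complex" where
  "W s x = branch (snd x * r) (fst x + of_real s * \<i> * of_real (snd x) * of_real K)"

section \<open>Identities and inequalities between the constants \<open>Q\<close>, \<open>K\<close>,
  \<open>r\<close> and \<open>v\<close>\<close>

lemma ec: "0 < \<epsilon> * c" "(\<epsilon> * c)\<^sup>2 < 1"
  using \<epsilon>_pos c_pos c_less by (auto simp: power_less_one_iff abs_square_less_1)

lemma ev: "0 < \<epsilon> * v" "(\<epsilon> * v)\<^sup>2 < 1"
  using \<epsilon>_pos v_pos v_less by (auto simp: power_less_one_iff abs_square_less_1)

lemma Q_alt: "Q = 1 - (\<epsilon> * c)\<^sup>2 * (\<epsilon> * v)\<^sup>2"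
  by (simp add: Q_def power_mult_distrib power4_eq_xxxx power2_eq_square)

lemma Q_bounds: "0 < Q" "1 - (\<epsilon> * c)\<^sup>2 < Q"
proof -
  have "(\<epsilon> * c)\<^sup>2 * (\<epsilon> * v)\<^sup>2 < (\<epsilon> * c)\<^sup>2 * 1"
    using ec ev by (intro mult_strict_left_mono) auto
  then show "1 - (\<epsilon> * c)\<^sup>2 < Q" by (simp add: Q_alt)
  then show "0 < Q" using ec by simp
qed

lemma QK: "Q * K = (1 - \<epsilon>\<^sup>2 * c\<^sup>2) * v"
  using Q_bounds by (simp add: C2_def flip: Q_def)

lemma Qr: "Q * r = (1 - \<epsilon>\<^sup>2 * v\<^sup>2) * c"
  using Q_bounds by (simp add: r_def C1_def flip: Q_def)

text \<open>After another multiplication by \<open>Q\<close> this is a polynomial identity in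
  \<open>\<epsilon>\<close>, \<open>c\<close> and \<open>v\<close>. It gives the constant
  coefficient of the quadratic in \<open>symbol_square\<close>.\<close>

lemma Q_K2_r2: "Q * (K\<^sup>2 - r\<^sup>2) = v\<^sup>2 - c\<^sup>2"
proof -
  have "Q * (Q * (K\<^sup>2 - r\<^sup>2)) = (Q * K)\<^sup>2 - (Q * r)\<^sup>2"
    by (simp add: power2_eq_square algebra_simps)
  also have "\<dots> = Q * (v\<^sup>2 - c\<^sup>2)"
    unfolding QK Qr by (simp add: Q_def power2_eq_square power4_eq_xxxx algebra_simps)
  finally show ?thesis using Q_bounds by simp
qed

lemma r_pos: "0 < r" and K_pos: "0 < K"
proof -
  have "0 < Q * r" unfolding Qr using ev c_pos by (simp add: power_mult_distrib)
  then show "0 < r" using Q_bounds by (simp add: zero_less_mult_iff)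
  have "0 < Q * K" unfolding QK using ec v_pos by (simp add: power_mult_distrib)
  then show "0 < K" using Q_bounds by (simp add: zero_less_mult_iff)
qed

lemma K_less_v: "K < v"
proof -
  have "Q * K < Q * v" unfolding QK using Q_bounds(2) v_pos by (simp add: power_mult_distrib)
  then show ?thesis using Q_bounds by simp
qed

text \<open>Multiplied by \<open>Q\<close>, the difference factors into positive terms.\<close>

lemma v_less_K_plus_r: "v < K + r"
proof -
  have "Q * (K + r) - Q * v = c * (1 - (\<epsilon> * v)\<^sup>2) * (1 - (\<epsilon> * c) * (\<epsilon> * v))"
    unfolding distrib_left QK Qr
    by (simp add: Q_def power2_eq_square power4_eq_xxxx algebra_simps)
  also have "0 < \<dots>"
    using ec ev c_less v_less c_pos mult_strict_mono[of "\<epsilon> * c" 1 "\<epsilon> * v" 1] by simp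
  finally show ?thesis using Q_bounds by (simp add: zero_less_mult_iff flip: right_diff_distrib)
qed

text \<open>Places \<open>1 / (\<epsilon>\<^sup>2 * v)\<close>, the modulus of
  \<open>\<tau> / \<eta>\<close> at which the numerator of \<open>m_fn\<close> vanishes, beyond the
  branch points.\<close>

lemma K_plus_r_less: "\<epsilon>\<^sup>2 * v * (K + r) < 1"
proof -
  have "Q - Q * (\<epsilon>\<^sup>2 * v * (K + r)) = Q - \<epsilon>\<^sup>2 * v * (Q * K + Q * r)"
    by (simp add: algebra_simps)
  also have "\<dots> = (1 - (\<epsilon> * v)\<^sup>2) * (1 - (\<epsilon> * c) * (\<epsilon> * v))"
    unfolding QK Qr by (simp add: Q_def power2_eq_square power4_eq_xxxx algebra_simps)
  also have "0 < \<dots>"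
    using ec ev c_less v_less mult_strict_mono[of "\<epsilon> * c" 1 "\<epsilon> * v" 1] by simp
  finally show ?thesis using Q_bounds by simp
qed

lemma G_pos: "0 < G"
  using ev by (simp add: Gam_def power_mult_distrib)

section \<open>Closed form of \<open>omega\<close> up to the boundary\<close>

lemma W_power2:
  "(W s x)\<^sup>2 = (fst x + of_real s * \<i> * of_real (snd x) * of_real K)\<^sup>2 + (of_real (snd x * r))\<^sup>2"
  unfolding W_def by (rule branch_power2)

text \<open>Completing the square in \<open>\<tau>\<close>: the left-hand side is a quadratic with
  leading coefficient \<open>Q\<close>, and its other coefficients are given by \<open>QK\<close>
  and \<open>Q_K2_r2\<close>.\<close>

lemma symbol_square:
  assumes "s \<in> {1, -1}"
  shows "(transp v s (\<tau>, \<eta>))\<^sup>2 - (of_real c)\<^sup>2 * (\<i> * of_real \<eta> + of_real s * of_real (\<epsilon>\<^sup>2) * of_real v * \<tau>)\<^sup>2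
    = of_real Q * (W s (\<tau>, \<eta>))\<^sup>2"
proof -
  define S where "S = complex_of_real s"
  have S: "S * S = 1" using assms by (auto simp: S_def)
  have "of_real Q * (W s (\<tau>, \<eta>))\<^sup>2 = of_real Q * \<tau>\<^sup>2 + 2 * S * \<i> * \<tau> * of_real \<eta> * of_real (Q * K)
      - (of_real \<eta>)\<^sup>2 * of_real (Q * (K\<^sup>2 - r\<^sup>2))"
    unfolding W_power2 using S i_squared
    by (simp only: fst_conv snd_conv of_real_mult of_real_diff of_real_power flip: S_def) algebra
  also have "\<dots> = (\<tau> + S * \<i> * of_real v * of_real \<eta>)\<^sup>2
      - (of_real c)\<^sup>2 * (\<i> * of_real \<eta> + S * of_real (\<epsilon>\<^sup>2) * of_real v * \<tau>)\<^sup>2"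
    unfolding QK Q_K2_r2 using S i_squared
    by (simp only: Q_def of_real_mult of_real_diff of_real_power of_real_1) algebra
  finally show ?thesis by (simp add: transp_def S_def)
qed

lemma omega_sq_eq:
  assumes "s \<in> {1, -1}"
  shows "omega_sq \<epsilon> c v s x = (of_real (G * sqrt Q / c) * W s x)\<^sup>2"
proof -
  obtain \<tau> \<eta> where x: "x = (\<tau>, \<eta>)" by (cases x)
  have "(complex_of_real (sqrt Q))\<^sup>2 = of_real Q"
    using Q_bounds by (simp flip: of_real_power)
  then have "(of_real (G * sqrt Q / c) * W s x)\<^sup>2 = (of_real G)\<^sup>2 / (of_real c)\<^sup>2 * (of_real Q * (W s x)\<^sup>2)"
    by (simp add: power_mult_distrib power_divide)
  then show ?thesis
    using c_pos unfolding x symbol_square[OF assms, symmetric]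
    by (simp add: omega_sq_def transp_def right_diff_distrib mult_ac)
qed

lemma continuous_on_W: "continuous_on Xi1 (W s)"
proof -
  have "0 \<le> Re (fst x + of_real s * \<i> * of_real (snd x) * of_real K)" if "x \<in> Xi1" for x
    using that by (auto simp: Xi1_def)
  then show ?thesis
    unfolding W_def by (intro continuous_on_branch continuous_intros) auto
qed

text \<open>In the interior \<open>omega_sq\<close> has two opposite square roots, and
  \<open>Re_branch_pos\<close> selects the one with the minus sign. Continuity of \<open>W\<close>
  carries the formula to the boundary.\<close>

lemma omega_eq:
  assumes "s \<in> {1, -1}" "x \<in> Xi1"
  shows "omega \<epsilon> c v s x = - (of_real (G * sqrt Q / c) * W s x)"
  unfolding omega_def
proof (rule cont_ext_eq[where T = Xi1])
  show "continuous_on Xi1 (\<lambda>x. - (of_real (G * sqrt Q / c) * W s x))"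
    by (intro continuous_intros continuous_on_W)
  show "x islimpt {x \<in> Xi1. 0 < Re (fst x)}" if "x \<notin> {x \<in> Xi1. 0 < Re (fst x)}"
    using that assms(2) by (intro Xi1_boundary_islimpt) (auto simp: Xi1_def)
  fix y assume "y \<in> {x \<in> Xi1. 0 < Re (fst x)}"
  then have "0 < Re (W s y)"
    unfolding W_def by (intro Re_branch_pos) simp
  then have "0 < G * sqrt Q / c * Re (W s y)"
    using G_pos Q_bounds c_pos by (intro mult_pos_pos divide_pos_pos) auto
  then have Re: "0 < Re (of_real (G * sqrt Q / c) * W s y)"
    by simp
  show "omega_interior \<epsilon> c v s y = - (of_real (G * sqrt Q / c) * W s y)"
    unfolding omega_interior_def omega_sq_eq[OF assms(1)]
  proof (rule the_equality)
    fix w assume w: "w\<^sup>2 = (of_real (G * sqrt Q / c) * W s y)\<^sup>2 \<and> Re w < 0"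
    then show "w = - (of_real (G * sqrt Q / c) * W s y)"
      using Re by (metis order_less_asym power2_eq_iff)
  qed (use Re in simp)
qed (use assms in auto)

section \<open>Pole-free formulas for the entries of \<open>E_plus\<close> and
  \<open>E_minus\<close>\<close>

definition E1 :: "real \<Rightarrow> complex \<times> real \<Rightarrow> complex" where
  "E1 s x = of_real (G / (2 * c)) * ((transp v s x)\<^sup>2 - of_real Q * (W s x)\<^sup>2)"
definition E2 :: "real \<Rightarrow> complex \<times> real \<Rightarrow> complex" where
  "E2 s x = of_real (G / (2 * c)) * (transp v s x + of_real (sqrt Q) * W s x)\<^sup>2"

lemma continuous_on_E1: "continuous_on Xi1 (E1 s)" and continuous_on_E2: "continuous_on Xi1 (E2 s)"
  unfolding E1_def E2_def transp_def case_prod_beta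
  by (intro continuous_intros continuous_on_W)+

text \<open>The factor \<open>transp\<close> cancels the pole, and \<open>symbol_square\<close>
  expresses the remaining numerator through \<open>W\<close>.\<close>

lemma transp_m_fn:
  assumes "s \<in> {1, -1}" "transp v s x \<noteq> 0"
  shows "transp v s x * m_fn \<epsilon> c v s x = E1 s x"
proof -
  obtain \<tau> \<eta> where x: "x = (\<tau>, \<eta>)" by (cases x)
  have "E1 s x = of_real (G / (2 * c)) * ((of_real c)\<^sup>2 * (\<i> * of_real \<eta> + of_real s * of_real (\<epsilon>\<^sup>2) * of_real v * \<tau>)\<^sup>2)"
    unfolding E1_def x symbol_square[OF assms(1), symmetric] by simp
  also have "\<dots> = transp v s x * m_fn \<epsilon> c v s x"
    using assms(2) c_pos unfolding x by (simp add: m_fn_def power2_eq_square)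
  finally show ?thesis ..
qed

text \<open>With \<open>a = transp v s x\<close> and \<open>b = sqrt Q * W s x\<close>, the
  \<open>mu_fn\<close> term contributes \<open>a\<^sup>2 + b\<^sup>2\<close> and the
  \<open>omega\<close> term \<open>2 * a * b\<close>, both times \<open>G / (2 * c)\<close>;
  together they form a perfect square.\<close>

lemma transp_mu_fn:
  assumes "s \<in> {1, -1}" "transp v s x \<noteq> 0" "x \<in> Xi1"
  shows "transp v s x * (mu_fn \<epsilon> c v s x - omega \<epsilon> c v s x) = E2 s x"
proof -
  have "(complex_of_real (sqrt Q))\<^sup>2 = of_real Q"
    using Q_bounds by (simp flip: of_real_power)
  moreover have "transp v s x * (mu_fn \<epsilon> c v s x - omega \<epsilon> c v s x)
    = of_real G * (transp v s x)\<^sup>2 / of_real c - E1 s x + transp v s x * (of_real (G * sqrt Q / c) * W s x)"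
    unfolding mu_fn_def omega_eq[OF assms(1,3)] transp_m_fn[OF assms(1,2), symmetric]
    by (simp add: algebra_simps power2_eq_square)
  ultimately show ?thesis
    using c_pos by (simp add: E1_def E2_def field_simps power2_eq_square)
qed

text \<open>The real part of \<open>transp\<close> is that of \<open>\<tau>\<close>, so
  \<open>transp\<close> can vanish only on the boundary and the interior approximates such a
  point.\<close>

lemma transp_zero_islimpt:
  assumes "s \<in> {1, -1}" "x \<in> Xi1" "transp v s x = 0"
  shows "x islimpt {x \<in> Xi1. transp v s x \<noteq> 0}"
proof (rule islimpt_subset[OF Xi1_boundary_islimpt])
  have Re: "Re (transp v s y) = Re (fst y)" for y
    by (simp add: transp_def case_prod_beta)
  show "Re (fst x) = 0" using assms(3) Re[of x] by simp
  show "{y \<in> Xi1. 0 < Re (fst y)} \<subseteq> {x \<in> Xi1. transp v s x \<noteq> 0}"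
    using Re by (metis (mono_tags, lifting) Collect_mono order_less_irrefl zero_complex.sel(1))
qed fact

lemma E_plus_eq:
  assumes "x \<in> Xi1"
  shows "E_plus \<epsilon> c v x = vector [E1 1 x, E2 1 x, 0, 0]"
  unfolding E_plus_def
  by (rule cont_ext_eq[where T = Xi1])
    (use assms transp_m_fn[of 1] transp_mu_fn[of 1] transp_zero_islimpt[of 1] in
      \<open>auto intro!: continuous_on_vector_4 continuous_on_E1 continuous_on_E2 continuous_intros\<close>)

lemma E_minus_eq:
  assumes "x \<in> Xi1"
  shows "E_minus \<epsilon> c v x = vector [0, 0, E2 (-1) x, E1 (-1) x]"
  unfolding E_minus_def
  by (rule cont_ext_eq[where T = Xi1])
    (use assms transp_m_fn[of "-1"] transp_mu_fn[of "-1"] transp_zero_islimpt[of "-1"] in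
      \<open>auto intro!: continuous_on_vector_4 continuous_on_E1 continuous_on_E2 continuous_intros\<close>)

section \<open>Factorization of the determinant\<close>

definition P :: "complex \<times> real \<Rightarrow> complex" where
  "P x = (transp v 1 x + of_real (sqrt Q) * W 1 x) * (transp v (-1) x + of_real (sqrt Q) * W (-1) x)"
text \<open>\<open>D 1\<close> is the factor that carries the roots; \<open>D (-1)\<close> is its
  conjugate under changing the sign of \<open>W 1\<close>.\<close>

definition D :: "real \<Rightarrow> complex \<times> real \<Rightarrow> complex" where
  "D s x = (transp v 1 x)\<^sup>2 * W (-1) x + of_real s * ((transp v (-1) x)\<^sup>2 * W 1 x)"

text \<open>The sum and the difference of \<open>E1 s x\<close> and \<open>E2 s x\<close> share the
  factor \<open>transp v s x + sqrt Q * W s x\<close>. Extracting it for both signs gives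
  \<open>P\<close>, and what is left of the determinant is \<open>D 1\<close>.\<close>

lemma Lopatinskii_eq:
  assumes "x \<in> Xi1"
  shows "Lopatinskii \<epsilon> c v h x = - of_real (G * sqrt Q / (c ^ 3 * h)) * P x * D 1 x"
proof -
  obtain \<tau> \<eta> where x: "x = (\<tau>, \<eta>)" by (cases x)
  define k where "k = complex_of_real (G * c * h)"
  define q where "q = complex_of_real (sqrt Q)"
  define M where "M = \<beta> \<epsilon> c v h x ** transpose (vector [E_plus \<epsilon> c v x, E_minus \<epsilon> c v x] :: complex ^ 4 ^ 2)"
  have \<beta>: "\<beta> \<epsilon> c v h x $ 1 = vector [1, 1, -1, -1]"
    "\<beta> \<epsilon> c v h x $ 2 = vector [transp v (-1) x / k, - transp v (-1) x / k, - transp v 1 x / k, transp v 1 x / k]"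
    by (simp_all add: \<beta>_def x Let_def transp_def k_def mult.assoc)
  have q2: "of_real Q = q\<^sup>2"
    unfolding q_def using Q_bounds by (simp flip: of_real_power)
  have "M $ 1 $ 1 = E1 1 x + E2 1 x" "M $ 2 $ 1 = transp v (-1) x / k * (E1 1 x - E2 1 x)"
    "M $ 1 $ 2 = - (E1 (-1) x + E2 (-1) x)" "M $ 2 $ 2 = transp v 1 x / k * (E1 (-1) x - E2 (-1) x)"
    unfolding M_def matrix_matrix_mult_def
    by (simp_all add: \<beta> sum_4 transpose_def E_plus_eq[OF assms] E_minus_eq[OF assms] algebra_simps)
  then have det: "det M = (E1 1 x + E2 1 x) * (transp v 1 x / k * (E1 (-1) x - E2 (-1) x))
     + (E1 (-1) x + E2 (-1) x) * (transp v (-1) x / k * (E1 1 x - E2 1 x))"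
    by (simp only: det_2 mult_minus_left diff_minus_eq_add)
  have f: "of_real (G / c) = 2 * complex_of_real (G / (2 * c))" by simp
  have E: "E1 s x + E2 s x = of_real (G / c) * (transp v s x + q * W s x) * transp v s x"
    "E1 s x - E2 s x = - of_real (G / c) * (transp v s x + q * W s x) * (q * W s x)" for s
    unfolding E1_def E2_def q2 q_def[symmetric] f by algebra+
  \<comment> \<open>Treating \<open>inverse k\<close> as an atom turns the claim into a polynomial
    identity.\<close>
  have "det M = - ((of_real (G / c))\<^sup>2 * q / k) * P x * D 1 x"
    unfolding det E P_def D_def q_def[symmetric] divide_inverse[of _ k] of_real_1 by algebra
  moreover have "(of_real (G / c))\<^sup>2 * q / k = of_real (G * sqrt Q / (c ^ 3 * h))"
    using G_pos c_pos by (simp add: k_def q_def power2_eq_square power3_eq_cube)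
  ultimately show ?thesis by (simp only: Lopatinskii_def flip: M_def)
qed

end

section \<open>The roots of the Lopatinskii determinant\<close>

text \<open>The quadratic is positive at 0 and negative at \<open>p1\<close>, so it has a root in
  between; negativity at \<open>p2\<close> forces the other root beyond \<open>p2\<close>.\<close>

lemma quadratic_roots_separated:
  fixes A B C p1 p2 :: real
  assumes "0 < A" "0 < C" "0 < p1" "p1 < p2"
    and "A * p1\<^sup>2 + B * p1 + C < 0" "A * p2\<^sup>2 + B * p2 + C < 0"
  obtains u1 u2 where "0 < u1" "u1 < p1" "p2 < u2" "B = - A * (u1 + u2)" "C = A * u1 * u2"
proof -
  have "\<exists>u\<ge>0. u \<le> p1 \<and> - (A * u\<^sup>2 + B * u + C) = 0"
    using assms by (intro IVT' continuous_intros) auto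
  then obtain u1 where u1: "0 \<le> u1" "u1 \<le> p1" "A * u1\<^sup>2 + B * u1 + C = 0" by auto
  have "u1 \<noteq> 0" using u1(3) assms(2) by auto
  have "u1 \<noteq> p1" using u1(3) assms(5) by auto
  \<comment> \<open>The second root comes from Vieta's formula for the sum of the roots.\<close>
  define u2 where "u2 = - B / A - u1"
  have B: "B = - A * (u1 + u2)" using assms(1) by (simp add: u2_def)
  have C: "C = A * u1 * u2" using u1(3) B by (simp add: algebra_simps power2_eq_square)
  have "A * p2\<^sup>2 + B * p2 + C = A * ((p2 - u1) * (p2 - u2))"
    unfolding B C by (simp add: algebra_simps power2_eq_square)
  then have "(p2 - u1) * (p2 - u2) < 0"
    using assms(1,6) by (simp add: mult_less_0_iff)
  then have "p2 < u2" using u1(2) assms(4) by (simp add: mult_less_0_iff)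
  then show ?thesis
    using that[of u1 u2] u1 \<open>u1 \<noteq> 0\<close> \<open>u1 \<noteq> p1\<close> B C by simp
qed

context vortex_sheet
begin

section \<open>Values and signs on the imaginary axis\<close>

definition \<theta> :: "real \<Rightarrow> real" where
  "\<theta> y = sgn y * sqrt (y\<^sup>2 - r\<^sup>2)"

lemma \<theta>_sign:
  assumes "r < \<bar>y\<bar>"
  shows "0 < \<theta> y \<longleftrightarrow> 0 < y" "\<theta> y < 0 \<longleftrightarrow> y < 0"
proof -
  have "r\<^sup>2 < y\<^sup>2" using power_strict_mono[OF assms, of 2] r_pos by simp
  then show "0 < \<theta> y \<longleftrightarrow> 0 < y" "\<theta> y < 0 \<longleftrightarrow> y < 0"
    by (auto simp: \<theta>_def zero_less_mult_iff mult_less_0_iff sgn_if)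
qed

text \<open>Scaling by \<open>\<eta>\<close> pulls out
  \<open>sgn \<eta> * \<bar>\<eta>\<bar> = \<eta>\<close>, so \<open>W s\<close> divided by
  \<open>\<i> * \<eta>\<close> is real and depends on \<open>z\<close> alone.\<close>

lemma W_axis:
  assumes "\<eta> \<noteq> 0" "r < \<bar>z + s * K\<bar>"
  shows "W s (\<i> * of_real z * of_real \<eta>, \<eta>) = \<i> * of_real \<eta> * of_real (\<theta> (z + s * K))"
proof -
  have "\<bar>\<eta> * r\<bar> < \<bar>\<eta> * (z + s * K)\<bar>"
    using assms r_pos by (simp add: abs_mult)
  then have "W s (\<i> * of_real z * of_real \<eta>, \<eta>)
      = \<i> * of_real (sgn (\<eta> * (z + s * K)) * sqrt ((\<eta> * (z + s * K))\<^sup>2 - (\<eta> * r)\<^sup>2))"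
    unfolding W_def by (subst branch_imaginary[symmetric]) (simp_all add: algebra_simps)
  also have "(\<eta> * (z + s * K))\<^sup>2 - (\<eta> * r)\<^sup>2 = \<eta>\<^sup>2 * ((z + s * K)\<^sup>2 - r\<^sup>2)"
    by (simp only: power_mult_distrib right_diff_distrib)
  also have "sgn (\<eta> * (z + s * K)) * sqrt (\<eta>\<^sup>2 * ((z + s * K)\<^sup>2 - r\<^sup>2))
      = (sgn \<eta> * \<bar>\<eta>\<bar>) * \<theta> (z + s * K)"
    by (simp add: \<theta>_def sgn_mult real_sqrt_mult)
  finally show ?thesis by (simp add: sgn_mult_abs mult.assoc)
qed

lemma transp_axis:
  "transp v s (\<i> * of_real z * of_real \<eta>, \<eta>) = \<i> * of_real \<eta> * of_real (z + s * v)"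
  by (simp add: transp_def algebra_simps)

lemma D_axis:
  assumes "\<eta> \<noteq> 0" "r < \<bar>z + K\<bar>" "r < \<bar>z - K\<bar>"
  shows "D s (\<i> * of_real z * of_real \<eta>, \<eta>)
    = (\<i> * of_real \<eta>) ^ 3 * of_real ((z + v)\<^sup>2 * \<theta> (z - K) + s * ((z - v)\<^sup>2 * \<theta> (z + K)))"
proof -
  have W: "W 1 (\<i> * of_real z * of_real \<eta>, \<eta>) = \<i> * of_real \<eta> * of_real (\<theta> (z + K))"
    "W (-1) (\<i> * of_real z * of_real \<eta>, \<eta>) = \<i> * of_real \<eta> * of_real (\<theta> (z - K))"
    using W_axis[OF assms(1), of z 1] W_axis[OF assms(1), of z "-1"] assms(2,3) by simp_all
  show ?thesis
    unfolding D_def transp_axis W of_real_mult of_real_add of_real_diff of_real_power of_real_minus of_real_1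
    by algebra
qed

text \<open>A zero would give \<open>(transp v s x)\<^sup>2 = Q * (W s x)\<^sup>2\<close>, so by
  \<open>symbol_square\<close> the numerator of \<open>m_fn\<close> would vanish. This fixes an
  imaginary \<open>\<tau>\<close> beyond the branch points, where \<open>transp\<close> and
  \<open>W\<close>, divided by \<open>\<i> * \<eta>\<close>, have the same sign and cannot
  cancel.\<close>

lemma factor_nonzero:
  assumes "x \<in> Xi1" "s \<in> {1, -1}"
  shows "transp v s x + of_real (sqrt Q) * W s x \<noteq> 0"
proof
  assume zero: "transp v s x + of_real (sqrt Q) * W s x = 0"
  obtain \<tau> \<eta> where x: "x = (\<tau>, \<eta>)" by (cases x)
  have "(complex_of_real (sqrt Q))\<^sup>2 = of_real Q"
    using Q_bounds by (simp flip: of_real_power)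
  then have "(transp v s x)\<^sup>2 = of_real Q * (W s x)\<^sup>2"
    using zero by (metis add_eq_0_iff2 power2_minus power_mult_distrib)
  then have b: "\<i> * of_real \<eta> + of_real s * of_real (\<epsilon>\<^sup>2) * of_real v * \<tau> = 0"
    using symbol_square[OF assms(2), of \<tau> \<eta>] c_pos by (simp add: x)
  define z where "z = - s / (\<epsilon>\<^sup>2 * v)"
  have ne: "\<epsilon>\<^sup>2 * v \<noteq> 0" using \<epsilon>_pos v_pos by simp
  have "\<i> * of_real \<eta> + of_real s * of_real (\<epsilon>\<^sup>2 * v) * \<tau> = 0"
    using b by (simp add: mult.assoc)
  then have "of_real s * of_real (\<epsilon>\<^sup>2 * v) * \<tau> = - \<i> * of_real \<eta>"
    by (simp add: add_eq_0_iff2)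
  then have "of_real s * (of_real s * of_real (\<epsilon>\<^sup>2 * v) * \<tau>) = - of_real s * \<i> * of_real \<eta>"
    by simp
  then have "of_real (\<epsilon>\<^sup>2 * v) * \<tau> = - of_real s * \<i> * of_real \<eta>"
    using assms(2) by auto
  then have \<tau>: "\<tau> = \<i> * of_real z * of_real \<eta>"
    using ne by (simp add: z_def field_simps)
  have \<eta>: "\<eta> \<noteq> 0"
    using assms(1) by (auto simp: x \<tau> Xi1_def)
  define w where "w = 1 / (\<epsilon>\<^sup>2 * v)"
  have w: "K + r < w" "v < w"
    using K_plus_r_less ev \<epsilon>_pos v_pos by (auto simp: w_def field_simps power2_eq_square)
  have zw: "z = - s * w" by (simp add: z_def w_def)
  have "r < \<bar>z + s * K\<bar>"
    using assms(2) w r_pos by (auto simp: zw)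
  moreover have "0 < (z + s * v) * \<theta> (z + s * K)"
    using assms(2) w K_pos r_pos \<theta>_sign[of "z + s * K"] by (auto simp: zw zero_less_mult_iff)
  then have "(z + s * v) \<noteq> - sqrt Q * \<theta> (z + s * K)"
    using Q_bounds(1) by (auto simp: zero_less_mult_iff mult_less_0_iff)
  then have "(z + s * v) + sqrt Q * \<theta> (z + s * K) \<noteq> 0" by simp
  moreover have "transp v s x + of_real (sqrt Q) * W s x
      = \<i> * of_real \<eta> * of_real ((z + s * v) + sqrt Q * \<theta> (z + s * K))"
    unfolding x \<tau> transp_axis W_axis[OF \<eta> \<open>r < \<bar>z + s * K\<bar>\<close>] by (simp add: algebra_simps)
  ultimately show False
    using zero \<eta> by (metis mult_eq_0_iff of_real_eq_0_iff complex_i_not_zero)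
qed

lemma P_nonzero: "x \<in> Xi1 \<Longrightarrow> P x \<noteq> 0"
  by (simp add: P_def factor_nonzero)

section \<open>The dispersion polynomial\<close>

definition q2 where "q2 = 2 * v - K"
definition q1 where "q1 = 2 * v ^ 3 + 2 * v * (K\<^sup>2 - r\<^sup>2) - 6 * K * v\<^sup>2"
definition q0 where "q0 = 2 * v ^ 3 * (K\<^sup>2 - r\<^sup>2) - K * v ^ 4"

text \<open>Up to the factor \<open>(\<i> \<eta>)\<^sup>6\<close>, the left-hand side is \<open>D 1 * D (-1)\<close> at \<open>\<tau> = \<i> \<eta> z\<close>.\<close>

lemma dispersion_polynomial:
  "(z + v) ^ 4 * ((z - K)\<^sup>2 - r\<^sup>2) - (z - v) ^ 4 * ((z + K)\<^sup>2 - r\<^sup>2)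
    = 4 * z * (q2 * (z\<^sup>2)\<^sup>2 + q1 * z\<^sup>2 + q0)"
  unfolding q2_def q1_def q0_def by algebra

text \<open>A difference of squares contains \<open>W\<close> only through its square. The result is
  the homogenized form of \<open>dispersion_polynomial\<close>, valid also for
  \<open>\<eta> = 0\<close>.\<close>

lemma D_product:
  "D 1 (\<tau>, \<eta>) * D (-1) (\<tau>, \<eta>) = 4 * \<i> * of_real \<eta> * \<tau> *
     (of_real q2 * \<tau> ^ 4 - of_real q1 * \<tau>\<^sup>2 * (of_real \<eta>)\<^sup>2 + of_real q0 * (of_real \<eta>) ^ 4)"
proof -
  have "D 1 (\<tau>, \<eta>) * D (-1) (\<tau>, \<eta>)
    = (transp v 1 (\<tau>, \<eta>)) ^ 4 * (W (-1) (\<tau>, \<eta>))\<^sup>2 - (transp v (-1) (\<tau>, \<eta>)) ^ 4 * (W 1 (\<tau>, \<eta>))\<^sup>2"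
    by (simp add: D_def algebra_simps power2_eq_square power4_eq_xxxx)
  also have "\<dots> = 4 * \<i> * of_real \<eta> * \<tau> *
     (of_real q2 * \<tau> ^ 4 - of_real q1 * \<tau>\<^sup>2 * (of_real \<eta>)\<^sup>2 + of_real q0 * (of_real \<eta>) ^ 4)"
    unfolding W_power2 transp_def q2_def q1_def q0_def using i_squared
    by (simp only: prod.case fst_conv snd_conv of_real_mult of_real_add of_real_diff of_real_power
        of_real_numeral of_real_1 of_real_minus) algebra
  finally show ?thesis .
qed

section \<open>Smooth factorization near a root\<close>

definition lin :: "complex \<Rightarrow> complex \<times> real \<Rightarrow> complex" where
  "lin k x = fst x + k * of_real (snd x)"

lemma bounded_linear_lin: "bounded_linear (lin k)"
  unfolding lin_def
  by (intro bounded_linear_add bounded_linear_fst bounded_linear_compose[OF bounded_linear_mult_right]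
      bounded_linear_compose[OF bounded_linear_of_real] bounded_linear_snd)

text \<open>The ambient set where all four radicands occurring in \<open>W 1\<close> and
  \<open>W (-1)\<close> avoid the cut of \<open>csqrt\<close>.\<close>

definition regular :: "(complex \<times> real) set" where
  "regular = (\<Inter>k\<in>{K + r, K - r, - K + r, - K - r}. lin (\<i> * of_real k) -` (- \<real>\<^sub>\<le>\<^sub>0))"

lemma open_regular: "open regular"
  unfolding regular_def
  by (intro open_INT ballI open_vimage linear_continuous_on bounded_linear_lin) auto

text \<open>On the axis each radicand is a nonzero imaginary number, because \<open>z\<close>
  differs from all four branch points.\<close>

lemma axis_regular:
  assumes "\<eta> \<noteq> 0" "r < \<bar>z + K\<bar>" "r < \<bar>z - K\<bar>"
  shows "(\<i> * of_real z * of_real \<eta>, \<eta>) \<in> regular"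
proof -
  have "lin (\<i> * of_real k) (\<i> * of_real z * of_real \<eta>, \<eta>) = \<i> * of_real ((z + k) * \<eta>)" for k
    by (simp add: lin_def algebra_simps)
  then have "lin (\<i> * of_real k) (\<i> * of_real z * of_real \<eta>, \<eta>) \<notin> \<real>\<^sub>\<le>\<^sub>0" if "z + k \<noteq> 0" for k
    using that assms(1) by (simp add: complex_nonpos_Reals_iff)
  then show ?thesis
    using assms r_pos
    by (auto simp: regular_def simp del: of_real_add of_real_diff of_real_minus)
qed

lemma elementary_on_W:
  assumes "S \<subseteq> regular" "s \<in> {1, -1}"
  shows "elementary_on S (W s)"
proof -
  have "W s = (\<lambda>x. csqrt (lin (\<i> * of_real (s * K + r)) x) * csqrt (lin (\<i> * of_real (s * K - r)) x))"
    by (simp add: fun_eq_iff W_def branch_def lin_def algebra_simps del: csqrt.simps)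
  moreover have "elementary_on S (\<lambda>x. csqrt (lin (\<i> * of_real k) x))"
    if "k \<in> {K + r, K - r, - K + r, - K - r}" for k
    using assms(1) that
    by (intro elementary_on.csqrt elementary_on.linear bounded_linear_lin) (auto simp: regular_def)
  ultimately show ?thesis
    using assms(2)
    by (auto intro!: elementary_on.mult simp del: of_real_add of_real_diff of_real_minus)
qed

lemma elementary_on_transp: "elementary_on S (transp v s)"
proof -
  have "transp v s = lin (of_real s * \<i> * of_real v)"
    by (simp add: fun_eq_iff transp_def lin_def)
  then show ?thesis
    by (simp add: elementary_on.linear bounded_linear_lin)
qed

lemma elementary_on_P: "S \<subseteq> regular \<Longrightarrow> elementary_on S P"
  unfolding P_def
  by (intro elementary_on_intros elementary_on_transp elementary_on_W) auto

lemma elementary_on_D: "S \<subseteq> regular \<Longrightarrow> elementary_on S (D s)"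
  unfolding D_def
  by (intro elementary_on_intros elementary_on_transp elementary_on_W) auto

text \<open>Near \<open>x0\<close> the conjugate \<open>D (-1)\<close> can be divided out, so
  \<open>D 1\<close> is the linear factor times \<open>R / D (-1)\<close>. Smoothness holds because
  the neighborhood stays in \<open>regular\<close>.\<close>

lemma simple_root:
  assumes "x0 \<in> Xi1" "x0 \<in> regular" "D (-1) x0 \<noteq> 0" "R x0 \<noteq> 0" "h \<noteq> 0"
    and R: "elementary_on UNIV R"
    and factor: "\<And>x. D 1 x * D (-1) x = (fst x - \<i> * of_real q * of_real (snd x)) * R x"
  shows "\<exists>V hq. openin (top_of_set Xi1) V \<and> x0 \<in> V \<and> smooth_on_subset hq V
     \<and> (\<forall>(\<tau>, \<eta>)\<in>V. Lopatinskii \<epsilon> c v h (\<tau>, \<eta>) = (\<tau> - \<i> * of_real q * of_real \<eta>) * hq (\<tau>, \<eta>)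
          \<and> hq (\<tau>, \<eta>) \<noteq> 0)"
proof -
  \<comment> \<open>Restriction to a smaller set, by induction over the construction of
    \<open>R\<close>.\<close>
  have R: "elementary_on S R" for S
    using R by (induction) (auto intro: elementary_on.intros)
  define U where "U = regular \<inter> (\<lambda>x. D (-1) x * R x) -` (- {0})"
  have "open U"
    unfolding U_def
    by (intro continuous_open_preimage elementary_on_continuous elementary_on.mult elementary_on_D R
        open_regular) auto
  define hq where "hq x = - of_real (G * sqrt Q / (c ^ 3 * h)) * P x * R x / D (-1) x" for x
  have "U \<subseteq> regular" by (auto simp: U_def)
  then have "elementary_on U hq"
    unfolding hq_def
    by (intro elementary_on_divide elementary_on_intros elementary_on_P elementary_on_D R)
      (auto simp: U_def)
  then have "smooth_on_open hq U"
    using \<open>open U\<close> by (rule elementary_on_smooth[rotated])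
  then have "smooth_on_subset hq (Xi1 \<inter> U)"
    unfolding smooth_on_subset_def by blast
  moreover have "Lopatinskii \<epsilon> c v h (\<tau>, \<eta>) = (\<tau> - \<i> * of_real q * of_real \<eta>) * hq (\<tau>, \<eta>) \<and> hq (\<tau>, \<eta>) \<noteq> 0"
    if "(\<tau>, \<eta>) \<in> Xi1 \<inter> U" for \<tau> \<eta>
  proof
    have ne: "D (-1) (\<tau>, \<eta>) \<noteq> 0" "R (\<tau>, \<eta>) \<noteq> 0" and x: "(\<tau>, \<eta>) \<in> Xi1"
      using that by (auto simp: U_def)
    have "D 1 (\<tau>, \<eta>) = (\<tau> - \<i> * of_real q * of_real \<eta>) * R (\<tau>, \<eta>) / D (-1) (\<tau>, \<eta>)"
      using factor[of "(\<tau>, \<eta>)"] ne by (simp add: eq_divide_eq)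
    then show "Lopatinskii \<epsilon> c v h (\<tau>, \<eta>) = (\<tau> - \<i> * of_real q * of_real \<eta>) * hq (\<tau>, \<eta>)"
      unfolding Lopatinskii_eq[OF x] hq_def by (simp only: times_divide_eq_right mult_ac)
    show "hq (\<tau>, \<eta>) \<noteq> 0"
      using ne P_nonzero[OF x] G_pos Q_bounds c_pos assms(5) by (simp add: hq_def)
  qed
  moreover have "openin (top_of_set Xi1) (Xi1 \<inter> U)" "x0 \<in> Xi1 \<inter> U"
    using \<open>open U\<close> assms(1-4) by (auto simp: U_def openin_open)
  ultimately show ?thesis
    by (intro exI[of _ "Xi1 \<inter> U"] exI[of _ hq]) auto
qed

end

section \<open>Location of the roots in the supersonic case\<close>

locale supersonic_vortex_sheet = vortex_sheet +
  assumes supersonic: "2 * c\<^sup>2 < v\<^sup>2 * (1 + \<epsilon>\<^sup>2 * c\<^sup>2)"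
begin

text \<open>The supersonic bound and \<open>\<epsilon> * c < 1\<close> give \<open>c < v\<close>,
  hence \<open>K\<^sup>2 - r\<^sup>2 > 0\<close> by \<open>Q_K2_r2\<close>.\<close>

lemma r_less_K: "r < K"
proof -
  have "v\<^sup>2 * (\<epsilon>\<^sup>2 * c\<^sup>2) < v\<^sup>2 * 1"
    using ec v_pos by (intro mult_strict_left_mono) (auto simp: power_mult_distrib)
  then have "0 < Q * (K\<^sup>2 - r\<^sup>2)"
    unfolding Q_K2_r2 using supersonic by (simp add: distrib_left)
  then have "r\<^sup>2 < K\<^sup>2" using Q_bounds by (simp add: zero_less_mult_iff)
  then show ?thesis using K_pos by (simp add: power2_less_imp_less)
qed

text \<open>Up to positive factors, \<open>q0\<close> is exactly the gap in the supersonic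
  inequality.\<close>

lemma q0_pos: "0 < q0"
proof -
  have "Q * q0 = v ^ 3 * (2 * (Q * (K\<^sup>2 - r\<^sup>2)) - (Q * K) * v)"
    by (simp add: q0_def algebra_simps power3_eq_cube power4_eq_xxxx)
  also have "2 * (Q * (K\<^sup>2 - r\<^sup>2)) - (Q * K) * v = v\<^sup>2 * (1 + \<epsilon>\<^sup>2 * c\<^sup>2) - 2 * c\<^sup>2"
    unfolding QK Q_K2_r2 by (simp add: algebra_simps power2_eq_square)
  finally have "0 < Q * q0" using supersonic v_pos by simp
  then show ?thesis using Q_bounds by (simp add: zero_less_mult_iff)
qed

lemma q2_pos: "0 < q2"
  using K_less_v v_pos by (simp add: q2_def)

text \<open>At \<open>z = K - r\<close> and \<open>z = K + r\<close> the first term of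
  \<open>dispersion_polynomial\<close> vanishes, and the remaining one is negative because
  \<open>z \<noteq> v\<close>.\<close>

lemma q_negative:
  "q2 * ((K - r)\<^sup>2)\<^sup>2 + q1 * (K - r)\<^sup>2 + q0 < 0" (is "?a < 0")
  "q2 * ((K + r)\<^sup>2)\<^sup>2 + q1 * (K + r)\<^sup>2 + q0 < 0" (is "?b < 0")
proof -
  have "(K - r) * ?a = - ((K - r - v) ^ 4 * (K * (K - r)))"
    using dispersion_polynomial[of "K - r"] by (simp add: power2_eq_square algebra_simps)
  moreover have "0 < (K - r - v) ^ 4 * (K * (K - r))"
    using K_less_v r_pos K_pos r_less_K by simp
  ultimately have "(K - r) * ?a < 0" by linarith
  then show "?a < 0" using r_less_K by (simp add: mult_less_0_iff)
  have "(K + r) * ?b = - ((K + r - v) ^ 4 * (K * (K + r)))"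
    using dispersion_polynomial[of "K + r"] by (simp add: power2_eq_square algebra_simps)
  moreover have "0 < (K + r - v) ^ 4 * (K * (K + r))"
    using v_less_K_plus_r r_pos K_pos by simp
  ultimately have "(K + r) * ?b < 0" by linarith
  then show "?b < 0" using r_pos K_pos by (simp add: mult_less_0_iff)
qed

text \<open>\<open>quadratic_roots_separated\<close> is applied to the quadratic in
  \<open>z\<^sup>2\<close>, positive at 0 and negative at both squared branch points.\<close>

lemma dispersion_roots:
  obtains z1 z2 where "0 < z1" "z1 < K - r" "K + r < z2"
    "\<And>\<tau> \<eta>. D 1 (\<tau>, \<eta>) * D (-1) (\<tau>, \<eta>) = 4 * of_real q2 * \<i> * of_real \<eta> * \<tau> *
       (\<tau>\<^sup>2 + (of_real z1 * of_real \<eta>)\<^sup>2) * (\<tau>\<^sup>2 + (of_real z2 * of_real \<eta>)\<^sup>2)"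
proof -
  have "(K - r)\<^sup>2 < (K + r)\<^sup>2"
    using K_pos r_pos by (simp add: power2_eq_square algebra_simps)
  then obtain u1 u2 where u: "0 < u1" "u1 < (K - r)\<^sup>2" "(K + r)\<^sup>2 < u2"
    "q1 = - q2 * (u1 + u2)" "q0 = q2 * u1 * u2"
    using quadratic_roots_separated[of q2 q0 "(K - r)\<^sup>2" "(K + r)\<^sup>2" q1] q2_pos q0_pos q_negative r_less_K
    by auto
  have "0 < u2" using u(3) by (smt (verit) zero_le_power2)
  define z1 where "z1 = sqrt u1"
  define z2 where "z2 = sqrt u2"
  have z: "u1 = z1\<^sup>2" "u2 = z2\<^sup>2"
    using u(1) \<open>0 < u2\<close> by (simp_all add: z1_def z2_def)
  show ?thesis
  proof (rule that)
    show "0 < z1" using u(1) by (simp add: z1_def)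
    show "z1 < K - r" using u(2) r_less_K by (simp add: z1_def real_less_lsqrt)
    show "K + r < z2" using u(3) by (simp add: z2_def real_less_rsqrt)
    show "D 1 (\<tau>, \<eta>) * D (-1) (\<tau>, \<eta>) = 4 * of_real q2 * \<i> * of_real \<eta> * \<tau> *
       (\<tau>\<^sup>2 + (of_real z1 * of_real \<eta>)\<^sup>2) * (\<tau>\<^sup>2 + (of_real z2 * of_real \<eta>)\<^sup>2)" for \<tau> \<eta>
      unfolding D_product u(4,5) z of_real_mult of_real_add of_real_minus of_real_power by algebra
  qed
qed

text \<open>Between the inner branch points \<open>\<theta> (z + K)\<close> and
  \<open>\<theta> (z - K)\<close> have opposite signs, so the two terms of the difference reinforce
  each other.\<close>

lemma D_minus_nonzero:
  assumes "\<eta> \<noteq> 0" "\<bar>z\<bar> < K - r"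
  shows "D (-1) (\<i> * of_real z * of_real \<eta>, \<eta>) \<noteq> 0"
proof -
  have "0 < z + K" "z - K < 0" "r < \<bar>z + K\<bar>" "r < \<bar>z - K\<bar>" "z + v \<noteq> 0" "z - v \<noteq> 0"
    using assms(2) r_pos K_less_v by auto
  then have "0 < (z - v)\<^sup>2 * \<theta> (z + K)" "(z + v)\<^sup>2 * \<theta> (z - K) < 0"
    using \<theta>_sign[of "z + K"] \<theta>_sign[of "z - K"] by (simp_all add: mult_less_0_iff)
  then have "(z + v)\<^sup>2 * \<theta> (z - K) + (-1) * ((z - v)\<^sup>2 * \<theta> (z + K)) \<noteq> 0"
    by linarith
  then show ?thesis
    using assms(1)
    unfolding D_axis[OF assms(1) \<open>r < \<bar>z + K\<bar>\<close> \<open>r < \<bar>z - K\<bar>\<close>]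
    by (simp only: mult_eq_0_iff power_eq_0_iff of_real_eq_0_iff complex_i_not_zero) simp
qed

text \<open>Beyond the outer branch points both values of \<open>\<theta>\<close> have the sign of
  \<open>z\<close>, so the sum cannot cancel. This discards the spurious roots.\<close>

lemma D_plus_nonzero:
  assumes "\<eta> \<noteq> 0" "K + r < \<bar>z\<bar>"
  shows "D 1 (\<i> * of_real z * of_real \<eta>, \<eta>) \<noteq> 0"
proof -
  have *: "r < \<bar>z + K\<bar>" "r < \<bar>z - K\<bar>" "z + v \<noteq> 0" "z - v \<noteq> 0"
    using assms(2) r_pos K_pos v_pos v_less_K_plus_r by auto
  have "(z + v)\<^sup>2 * \<theta> (z - K) + 1 * ((z - v)\<^sup>2 * \<theta> (z + K)) \<noteq> 0"
  proof (cases "0 < z")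
    case True
    then have "0 < \<theta> (z - K)" "0 < \<theta> (z + K)"
      using * assms(2) r_pos K_pos by (auto simp: \<theta>_sign)
    then have "0 < (z + v)\<^sup>2 * \<theta> (z - K)" "0 < (z - v)\<^sup>2 * \<theta> (z + K)"
      using * by simp_all
    then show ?thesis by linarith
  next
    case False
    then have "\<theta> (z - K) < 0" "\<theta> (z + K) < 0"
      using * assms(2) r_pos K_pos by (auto simp: \<theta>_sign)
    then have "(z + v)\<^sup>2 * \<theta> (z - K) < 0" "(z - v)\<^sup>2 * \<theta> (z + K) < 0"
      using * by (simp_all add: mult_less_0_iff)
    then show ?thesis by linarith
  qed
  then show ?thesis
    using assms(1)
    unfolding D_axis[OF assms(1) *(1,2)]
    by (simp only: mult_eq_0_iff power_eq_0_iff of_real_eq_0_iff complex_i_not_zero) simp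
qed

text \<open>The product in \<open>D_product\<close> vanishes identically for
  \<open>\<eta> = 0\<close> and says nothing there; \<open>D 1\<close> is computed directly from
  \<open>branch_0\<close>.\<close>

lemma D_eta_zero: "D 1 (\<tau>, 0) = 2 * \<tau> ^ 3"
  by (simp add: D_def W_def transp_def power2_eq_square power3_eq_cube)

lemma sum_squares_zeroD:
  fixes \<tau> a :: complex
  assumes "\<tau>\<^sup>2 + a\<^sup>2 = 0"
  shows "\<tau> = \<i> * a \<or> \<tau> = - (\<i> * a)"
proof -
  have "\<tau>\<^sup>2 = (\<i> * a)\<^sup>2"
    using assms by (simp add: power_mult_distrib eq_neg_iff_add_eq_0)
  then show ?thesis by (simp add: power2_eq_iff)
qed

lemma Lopatinskii_roots:
  assumes "h \<noteq> 0"
  shows "\<exists>z1. 0 < z1 \<and> z1 < K - r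
     \<and> (\<forall>(\<tau>, \<eta>) \<in> Xi1. Lopatinskii \<epsilon> c v h (\<tau>, \<eta>) = 0 \<longleftrightarrow>
           \<tau> \<in> {0, \<i> * of_real z1 * of_real \<eta>, - \<i> * of_real z1 * of_real \<eta>})
     \<and> (\<forall>q \<in> {0, - z1, z1}. \<forall>\<eta>. (\<i> * of_real q * of_real \<eta>, \<eta>) \<in> Xi1 \<longrightarrow>
           (\<exists>V hq. openin (top_of_set Xi1) V \<and> (\<i> * of_real q * of_real \<eta>, \<eta>) \<in> V
              \<and> smooth_on_subset hq V
              \<and> (\<forall>(\<tau>', \<eta>') \<in> V.
                   Lopatinskii \<epsilon> c v h (\<tau>', \<eta>') = (\<tau>' - \<i> * of_real q * of_real \<eta>') * hq (\<tau>', \<eta>')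
                   \<and> hq (\<tau>', \<eta>') \<noteq> 0)))"
proof -
  obtain z1 z2 where z: "0 < z1" "z1 < K - r" "K + r < z2"
    and prod: "\<And>\<tau> \<eta>. D 1 (\<tau>, \<eta>) * D (-1) (\<tau>, \<eta>) = 4 * of_real q2 * \<i> * of_real \<eta> * \<tau> *
       (\<tau>\<^sup>2 + (of_real z1 * of_real \<eta>)\<^sup>2) * (\<tau>\<^sup>2 + (of_real z2 * of_real \<eta>)\<^sup>2)"
    using dispersion_roots by blast
  have z2: "0 < z2" "z1 < z2" using z K_pos r_pos by auto
  have small: "\<bar>q\<bar> < K - r" if "q \<in> {0, - z1, z1}" for q
    using that z by auto
  \<comment> \<open>For \<open>\<eta> = 0\<close> the point would be the origin, which is off the
    unit sphere.\<close>
  have axis_Xi1: "\<eta> \<noteq> 0" if "(\<i> * of_real q * of_real \<eta>, \<eta>) \<in> Xi1" for q \<eta>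
    using that by (auto simp: Xi1_def)
  have "Lopatinskii \<epsilon> c v h (\<tau>, \<eta>) = 0 \<longleftrightarrow>
      \<tau> \<in> {0, \<i> * of_real z1 * of_real \<eta>, - \<i> * of_real z1 * of_real \<eta>}" if x: "(\<tau>, \<eta>) \<in> Xi1" for \<tau> \<eta>
  proof -
    have "Lopatinskii \<epsilon> c v h (\<tau>, \<eta>) = 0 \<longleftrightarrow> D 1 (\<tau>, \<eta>) = 0"
      using P_nonzero[OF x] G_pos Q_bounds c_pos assms by (simp add: Lopatinskii_eq[OF x])
    also have "\<dots> \<longleftrightarrow> \<tau> \<in> {0, \<i> * of_real z1 * of_real \<eta>, - \<i> * of_real z1 * of_real \<eta>}"
    proof (cases "\<eta> = 0")
      case True
      then have "\<tau> \<noteq> 0" using x by (auto simp: Xi1_def)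
      then show ?thesis using True by (simp add: D_eta_zero)
    next
      case False
      show ?thesis
      proof
        assume D: "D 1 (\<tau>, \<eta>) = 0"
        then have "\<tau> = 0 \<or> \<tau>\<^sup>2 + (of_real z1 * of_real \<eta>)\<^sup>2 = 0 \<or> \<tau>\<^sup>2 + (of_real z2 * of_real \<eta>)\<^sup>2 = 0"
          using prod[of \<tau> \<eta>] False q2_pos by simp
        moreover have "\<tau>\<^sup>2 + (of_real z2 * of_real \<eta>)\<^sup>2 \<noteq> 0"
        proof
          assume "\<tau>\<^sup>2 + (of_real z2 * of_real \<eta>)\<^sup>2 = 0"
          from sum_squares_zeroD[OF this] have "\<tau> = \<i> * of_real z2 * of_real \<eta> \<or> \<tau> = \<i> * of_real (- z2) * of_real \<eta>"
            by (simp add: mult.assoc)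
          then show False
            using D D_plus_nonzero[OF False, of z2] D_plus_nonzero[OF False, of "- z2"] z(3) z2(1) by auto
        qed
        ultimately show "\<tau> \<in> {0, \<i> * of_real z1 * of_real \<eta>, - \<i> * of_real z1 * of_real \<eta>}"
          using sum_squares_zeroD[of \<tau> "of_real z1 * of_real \<eta>"] by (auto simp: mult.assoc)
      next
        assume \<tau>: "\<tau> \<in> {0, \<i> * of_real z1 * of_real \<eta>, - \<i> * of_real z1 * of_real \<eta>}"
        then have "\<exists>q\<in>{0, - z1, z1}. \<tau> = \<i> * of_real q * of_real \<eta>" by auto
        then obtain q where q: "q \<in> {0, - z1, z1}" "\<tau> = \<i> * of_real q * of_real \<eta>" by blast
        have "D 1 (\<tau>, \<eta>) * D (-1) (\<tau>, \<eta>) = 0"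
          using \<tau> unfolding prod by (auto simp: power_mult_distrib)
        then show "D 1 (\<tau>, \<eta>) = 0"
          using D_minus_nonzero[OF False small[OF q(1)]] by (simp add: q(2))
      qed
    qed
    finally show ?thesis .
  qed
  moreover have "\<exists>V hq. openin (top_of_set Xi1) V \<and> (\<i> * of_real q * of_real \<eta>, \<eta>) \<in> V
        \<and> smooth_on_subset hq V
        \<and> (\<forall>(\<tau>', \<eta>') \<in> V.
             Lopatinskii \<epsilon> c v h (\<tau>', \<eta>') = (\<tau>' - \<i> * of_real q * of_real \<eta>') * hq (\<tau>', \<eta>')
             \<and> hq (\<tau>', \<eta>') \<noteq> 0)"
    if q: "q \<in> {0, - z1, z1}" and x: "(\<i> * of_real q * of_real \<eta>, \<eta>) \<in> Xi1" for q \<eta>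
  proof -
    \<comment> \<open>The cofactor of \<open>\<tau> - \<i> q \<eta>\<close> in
      \<open>\<tau> (\<tau>\<^sup>2 + z1\<^sup>2 \<eta>\<^sup>2)\<close>; for nonzero
      \<open>q\<close> it uses \<open>q\<^sup>2 = z1\<^sup>2\<close>.\<close>
    define R1 where "R1 x = (if q = 0 then (fst x)\<^sup>2 + (of_real z1 * of_real (snd x))\<^sup>2
      else fst x * (fst x + \<i> * of_real q * of_real (snd x)))" for x :: "complex \<times> real"
    define R where "R x = 4 * of_real q2 * \<i> * of_real (snd x) * R1 x
      * ((fst x)\<^sup>2 + (of_real z2 * of_real (snd x))\<^sup>2)" for x :: "complex \<times> real"
    have \<eta>: "\<eta> \<noteq> 0" by (rule axis_Xi1[OF x])
    have lin: "elementary_on UNIV fst" "elementary_on UNIV (\<lambda>x::complex \<times> real. complex_of_real (snd x))"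
      by (intro elementary_on.linear bounded_linear_fst
          bounded_linear_compose[OF bounded_linear_of_real] bounded_linear_snd)+
    show ?thesis
    proof (rule simple_root[where R = R])
      show "(\<i> * of_real q * of_real \<eta>, \<eta>) \<in> regular"
        using small[OF q] r_pos by (intro axis_regular \<eta>) auto
      show "D (-1) (\<i> * of_real q * of_real \<eta>, \<eta>) \<noteq> 0"
        by (rule D_minus_nonzero[OF \<eta> small[OF q]])
      show "elementary_on UNIV R"
        unfolding R_def R1_def by (cases "q = 0") (simp_all, (intro elementary_on_intros lin)+)
      show "D 1 x * D (-1) x = (fst x - \<i> * of_real q * of_real (snd x)) * R x" for x
      proof -
        have "(fst x - \<i> * of_real q * of_real (snd x)) * R1 x = fst x * ((fst x)\<^sup>2 + (of_real z1 * of_real (snd x))\<^sup>2)"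
          using q by (auto simp: R1_def power2_eq_square algebra_simps)
        then show ?thesis
          using prod[of "fst x" "snd x"] by (simp add: R_def mult_ac)
      qed
      \<comment> \<open>Keeps the factor belonging to \<open>z2\<close> from vanishing at the
        root.\<close>
      have "q\<^sup>2 < z2\<^sup>2" using q z(1) z2 by (auto simp: power_strict_mono)
      then have "z2\<^sup>2 - q\<^sup>2 \<noteq> 0" by simp
      moreover have "(\<i> * of_real q * of_real \<eta>)\<^sup>2 + (complex_of_real z2 * of_real \<eta>)\<^sup>2
          = of_real ((z2\<^sup>2 - q\<^sup>2) * \<eta>\<^sup>2)"
        by (simp add: power_mult_distrib algebra_simps)
      moreover have "R1 (\<i> * of_real q * of_real \<eta>, \<eta>) \<noteq> 0"
        using q z(1) \<eta> by (auto simp: R1_def)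
      ultimately show "R (\<i> * of_real q * of_real \<eta>, \<eta>) \<noteq> 0"
        using \<eta> q2_pos by (simp add: R_def del: of_real_mult of_real_diff of_real_power)
    qed (use x assms in auto)
  qed
  ultimately show ?thesis
    using z by (intro exI[of _ z1]) auto
qed

end

theorem lemma3p4:
  fixes \<epsilon> rho_lo \<rho> v c h :: real and rho_hi :: ereal and p :: "real \<Rightarrow> real"
  assumes "\<epsilon> > 0"
    and "0 \<le> rho_lo" and "ereal rho_lo < rho_hi"
    and "smooth_on_open p {r. rho_lo < r \<and> ereal r < rho_hi}"
    and "\<And>r. rho_lo < r \<Longrightarrow> ereal r < rho_hi \<Longrightarrow> 0 < deriv p r \<and> deriv p r < 1 / \<epsilon>\<^sup>2"
    and "rho_lo < \<rho>" and "ereal \<rho> < rho_hi"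
    and "0 < v" and "v < 1 / \<epsilon>"
    and "c = sqrt (deriv p \<rho>)"
    and "h = \<rho> + \<epsilon>\<^sup>2 * p \<rho>" and "h > 0"
    and "\<bar>v\<bar> / c > sqrt 2 / sqrt (1 + \<epsilon>\<^sup>2 * c\<^sup>2)"
  shows "\<exists>z1. 0 < z1
     \<and> z1 < C2 \<epsilon> c v - 1 / C1 \<epsilon> c v
     \<and> C2 \<epsilon> c v - 1 / C1 \<epsilon> c v < C2 \<epsilon> c v
     \<and> C2 \<epsilon> c v < v
     \<and> v < C2 \<epsilon> c v + 1 / C1 \<epsilon> c v
     \<and> (\<forall>(\<tau>, \<eta>) \<in> Xi1. Lopatinskii \<epsilon> c v h (\<tau>, \<eta>) = 0 \<longleftrightarrow>
           \<tau> \<in> {0, \<i> * of_real z1 * of_real \<eta>, - \<i> * of_real z1 * of_real \<eta>})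
     \<and> (\<forall>q \<in> {0, - z1, z1}. \<forall>\<eta>. (\<i> * of_real q * of_real \<eta>, \<eta>) \<in> Xi1 \<longrightarrow>
           (\<exists>V hq. openin (top_of_set Xi1) V \<and> (\<i> * of_real q * of_real \<eta>, \<eta>) \<in> V
              \<and> smooth_on_subset hq V
              \<and> (\<forall>(\<tau>', \<eta>') \<in> V.
                   Lopatinskii \<epsilon> c v h (\<tau>', \<eta>') = (\<tau>' - \<i> * of_real q * of_real \<eta>') * hq (\<tau>', \<eta>')
                   \<and> hq (\<tau>', \<eta>') \<noteq> 0)))"
proof -
  have p: "0 < deriv p \<rho>" "deriv p \<rho> < 1 / \<epsilon>\<^sup>2"
    using assms(5)[OF assms(6,7)] by auto
  then have c: "0 < c" "c\<^sup>2 < 1 / \<epsilon>\<^sup>2"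
    using assms(10) by simp_all
  have "(\<epsilon> * c)\<^sup>2 < 1\<^sup>2"
    using c(2) assms(1) by (simp add: power_mult_distrib field_simps)
  then have "\<epsilon> * c < 1" by (rule power2_less_imp_less) simp
  \<comment> \<open>The ratio hypothesis is cleared of denominators and squared to obtain the form
    assumed by the supersonic locale.\<close>
  define k where "k = 1 + \<epsilon>\<^sup>2 * c\<^sup>2"
  have k: "0 < k" by (simp add: k_def add_pos_nonneg)
  then have "sqrt 2 * c < v * sqrt k"
    using assms(8,13) c(1) by (simp add: field_simps flip: k_def)
  then have "(sqrt 2 * c)\<^sup>2 < (v * sqrt k)\<^sup>2"
    using c(1) by (intro power_strict_mono) auto
  then have "2 * c\<^sup>2 < v\<^sup>2 * k"
    using k by (simp add: power_mult_distrib)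
  then interpret supersonic_vortex_sheet \<epsilon> c v
    using assms(1,8,9) c(1) \<open>\<epsilon> * c < 1\<close>
    by unfold_locales (simp_all add: field_simps k_def)
  show ?thesis
    using Lopatinskii_roots[of h] assms(12) r_pos K_less_v v_less_K_plus_r
    unfolding r_def by auto
qed

end
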